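(* Let $\alpha\ge1$. If there is a polynomial-time $\tfrac1\alpha$-approximation algorithm for PSBA restricted to instances with $|E|=1$, then there is a polynomial-time $\tfrac{1}{\alpha+1}$-approximation algorithm for general instances of PSBA (with $|T|$ arbitrary, i.e., not necessarily polynomially bounded in the input size).
   Context: PSBA: Time is discrete; $T=\{1,\dots,|T|\}$ is the set of time slots ($|T|$ is part of the input, encoded in binary). There is a set $A$ of agents and a set $E$ of events; each event $e$ has length $l(e)\in\mathbb{N}_{\ge1}$ and, scheduled at slot $t$, occupies $\{t,\dots,t+l(e)-1\}$. Each agent $i$ has a job set $J_i$; each job $j$ has release time $r_j$, deadline $d_j$, processing time $p_j\le d_j-r_j+1$, and job interval $\{r_j,\dots,d_j\}$. A preemptive job schedule of $J_i$ is feasible if each job gets $p_j$ distinct slots in its interval and each slot holds at most one job of $J_i$; each $J_i$ is assumed feasible. An event schedule is a set $\mathcal S$ of pairs $(e,t)$ with $e\in E$, $t\in T$; complete if each event appears exactly once (overlaps allowed). A slot is an agreement slot of agent $i$ if it is occupied by some scheduled event and no job of $J_i$ is processed there; $\mathrm{agr}_i(\mathcal S)$ is the maximum number of agreement slots over feasible schedules of $J_i$. Goal: a complete event schedule maximizing $\sum_i\mathrm{agr}_i(\mathcal S)$. A $\rho$-approximation returns a complete schedule of value at least $\rho$ times the optimum. *)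

theory Defs
  imports Complex_Main "HOL-Computational_Algebra.Polynomial"
begin

section \<open>The scheduling problem PSBA\<close>

record job =
  release :: nat
  deadline :: nat
  proc :: nat

text \<open>
  Events, agents and the jobs of an agent are identified with their positions in the
  respective lists; an event is given by its length.  Two entries with equal data are
  different events (agents, jobs).
\<close>

record psba =
  num_slots :: nat
  event_len :: "nat list"
  job_sets :: "job list list"

definition time_slots :: "psba \<Rightarrow> nat set" where
  "time_slots I = {1..num_slots I}"

definition job_interval :: "job \<Rightarrow> nat set" where
  "job_interval j = {release j..deadline j}"

definition valid_job :: "psba \<Rightarrow> job \<Rightarrow> bool" where
  "valid_job I j \<longleftrightarrow> release j \<in> time_slots I \<and> deadline j \<in> time_slots I \<and>
     release j \<le> deadline j \<and> proc j \<le> deadline j - release j + 1"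

text \<open>
  A preemptive job schedule maps (the index of) a job to the set of slots in which the job
  is processed; its values outside the index range are irrelevant.
\<close>

definition feasible_job_schedule :: "job list \<Rightarrow> (nat \<Rightarrow> nat set) \<Rightarrow> bool" where
  "feasible_job_schedule J \<sigma> \<longleftrightarrow>
     (\<forall>j<length J. \<sigma> j \<subseteq> job_interval (J ! j) \<and> card (\<sigma> j) = proc (J ! j)) \<and>
     (\<forall>j<length J. \<forall>k<length J. j \<noteq> k \<longrightarrow> \<sigma> j \<inter> \<sigma> k = {})"

definition valid_psba :: "psba \<Rightarrow> bool" where
  "valid_psba I \<longleftrightarrow> num_slots I \<ge> 1 \<and> (\<forall>l\<in>set (event_len I). l \<ge> 1) \<and>
     (\<forall>J\<in>set (job_sets I). (\<forall>j\<in>set J. valid_job I j) \<and> (\<exists>\<sigma>. feasible_job_schedule J \<sigma>))"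

definition event_schedule :: "psba \<Rightarrow> (nat \<times> nat) set \<Rightarrow> bool" where
  "event_schedule I S \<longleftrightarrow> S \<subseteq> {..<length (event_len I)} \<times> time_slots I"

definition complete_schedule :: "psba \<Rightarrow> (nat \<times> nat) set \<Rightarrow> bool" where
  "complete_schedule I S \<longleftrightarrow>
     event_schedule I S \<and> (\<forall>e<length (event_len I). \<exists>!t. (e, t) \<in> S)"

text \<open>
  An event may be started so late that it extends beyond the last time slot; the part
  outside \<open>time_slots I\<close> does not contribute agreement slots.
\<close>

definition occupied_slots :: "psba \<Rightarrow> (nat \<times> nat) set \<Rightarrow> nat set" where
  "occupied_slots I S = time_slots I \<inter> (\<Union>(e, t)\<in>S. {t..<t + event_len I ! e})"

definition agreement_slots :: "psba \<Rightarrow> (nat \<times> nat) set \<Rightarrow> job list \<Rightarrow> (nat \<Rightarrow> nat set) \<Rightarrow> nat set" where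
  "agreement_slots I S J \<sigma> = occupied_slots I S - (\<Union>j<length J. \<sigma> j)"

definition agr :: "psba \<Rightarrow> nat \<Rightarrow> (nat \<times> nat) set \<Rightarrow> nat" where
  "agr I i S = Max {card (agreement_slots I S (job_sets I ! i) \<sigma>) | \<sigma>.
     feasible_job_schedule (job_sets I ! i) \<sigma>}"

definition schedule_value :: "psba \<Rightarrow> (nat \<times> nat) set \<Rightarrow> nat" where
  "schedule_value I S = (\<Sum>i<length (job_sets I). agr I i S)"

definition opt_value :: "psba \<Rightarrow> nat" where
  "opt_value I = Max {schedule_value I S | S. complete_schedule I S}"


section \<open>Machine model\<close>

text \<open>
  Programs are those of the WHILE language of N. D. Jones (Computability and Complexity from
  a Programming Perspective, MIT Press 1997): imperative programs over finitely many
  variables that hold binary trees (Lisp-like data), without any built-in arithmetic.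
  Evaluating an expression costs, for each of its subexpressions, one plus the size of the
  tree computed (as if that tree were copied).  Every unit of size that is ever created is
  thereby paid for, so polynomial running time agrees with polynomial time on
  multi-tape Turing machines.
\<close>

datatype data = Leaf | Node data data

text \<open>The generated function \<open>size\<close> on \<open>data\<close> counts the \<open>Node\<close> constructors.\<close>

datatype expr =
    EVar nat
  | ELeaf
  | ENode expr expr
  | EHd expr
  | ETl expr
  | EEq expr expr

datatype com =
    Assign nat expr
  | Seq com com
  | Cond expr com com
  | While expr com

type_synonym state = "nat \<Rightarrow> data"

fun data_hd :: "data \<Rightarrow> data" where
  "data_hd Leaf = Leaf"
| "data_hd (Node a b) = a"

fun data_tl :: "data \<Rightarrow> data" where
  "data_tl Leaf = Leaf"
| "data_tl (Node a b) = b"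

text \<open>The tree \<open>Leaf\<close> is read as false and every other tree as true.\<close>

definition data_of_bool :: "bool \<Rightarrow> data" where
  "data_of_bool b = (if b then Node Leaf Leaf else Leaf)"

fun eval :: "expr \<Rightarrow> state \<Rightarrow> data" where
  "eval (EVar x) s = s x"
| "eval ELeaf s = Leaf"
| "eval (ENode a b) s = Node (eval a s) (eval b s)"
| "eval (EHd a) s = data_hd (eval a s)"
| "eval (ETl a) s = data_tl (eval a s)"
| "eval (EEq a b) s = data_of_bool (eval a s = eval b s)"

fun eval_cost :: "expr \<Rightarrow> state \<Rightarrow> nat" where
  "eval_cost (EVar x) s = 1 + size (s x)"
| "eval_cost ELeaf s = 1"
| "eval_cost (ENode a b) s = 1 + size (eval (ENode a b) s) + eval_cost a s + eval_cost b s"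
| "eval_cost (EHd a) s = 1 + size (eval (EHd a) s) + eval_cost a s"
| "eval_cost (ETl a) s = 1 + size (eval (ETl a) s) + eval_cost a s"
| "eval_cost (EEq a b) s = 1 + size (eval (EEq a b) s) + eval_cost a s + eval_cost b s"

text \<open>
  \<open>exec c s n s'\<close>: started in state \<open>s\<close>, the program \<open>c\<close> terminates in state \<open>s'\<close> after
  time \<open>n\<close>.
\<close>

inductive exec :: "com \<Rightarrow> state \<Rightarrow> nat \<Rightarrow> state \<Rightarrow> bool" where
  Assign: "exec (Assign x e) s (1 + eval_cost e s) (s(x := eval e s))"
| Seq: "exec c1 s n1 s1 \<Longrightarrow> exec c2 s1 n2 s2 \<Longrightarrow> exec (Seq c1 c2) s (n1 + n2) s2"
| CondTrue: "eval e s \<noteq> Leaf \<Longrightarrow> exec c1 s n s1 \<Longrightarrow>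
    exec (Cond e c1 c2) s (1 + eval_cost e s + n) s1"
| CondFalse: "eval e s = Leaf \<Longrightarrow> exec c2 s n s1 \<Longrightarrow>
    exec (Cond e c1 c2) s (1 + eval_cost e s + n) s1"
| WhileFalse: "eval e s = Leaf \<Longrightarrow> exec (While e c) s (1 + eval_cost e s) s"
| WhileTrue: "eval e s \<noteq> Leaf \<Longrightarrow> exec c s n1 s1 \<Longrightarrow> exec (While e c) s1 n2 s2 \<Longrightarrow>
    exec (While e c) s (1 + eval_cost e s + n1 + n2) s2"

text \<open>Variable 0 holds the input initially (all other variables being empty) and the output
  finally.\<close>

definition computes_in :: "com \<Rightarrow> data \<Rightarrow> data \<Rightarrow> nat \<Rightarrow> bool" where
  "computes_in c inp out n \<longleftrightarrow> (\<exists>s. exec c ((\<lambda>_. Leaf)(0 := inp)) n s \<and> s 0 = out)"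


section \<open>Encodings\<close>

text \<open>Numbers are encoded in binary, as lists of bits with the least significant bit first.\<close>

fun enc_nat :: "nat \<Rightarrow> data" where
  "enc_nat n = (if n = 0 then Leaf else Node (data_of_bool (odd n)) (enc_nat (n div 2)))"

declare enc_nat.simps [simp del]

fun enc_list :: "('a \<Rightarrow> data) \<Rightarrow> 'a list \<Rightarrow> data" where
  "enc_list f [] = Leaf"
| "enc_list f (x # xs) = Node (f x) (enc_list f xs)"

definition enc_job :: "job \<Rightarrow> data" where
  "enc_job j = Node (enc_nat (release j)) (Node (enc_nat (deadline j)) (enc_nat (proc j)))"

definition enc_psba :: "psba \<Rightarrow> data" where
  "enc_psba I = Node (enc_nat (num_slots I))
     (Node (enc_list enc_nat (event_len I)) (enc_list (enc_list enc_job) (job_sets I)))"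

definition enc_schedule :: "(nat \<times> nat) list \<Rightarrow> data" where
  "enc_schedule = enc_list (\<lambda>(e, t). Node (enc_nat e) (enc_nat t))"


section \<open>Polynomial-time approximation algorithms\<close>

text \<open>
  The predicate \<open>P\<close> restricts the class of instances.  Nothing is required of the program on
  inputs that do not encode a valid instance in this class.
\<close>

definition polytime_approx :: "(psba \<Rightarrow> bool) \<Rightarrow> real \<Rightarrow> com \<Rightarrow> bool" where
  "polytime_approx P \<rho> c \<longleftrightarrow>
     (\<exists>p :: nat poly. \<forall>I. valid_psba I \<and> P I \<longrightarrow>
        (\<exists>xs n. computes_in c (enc_psba I) (enc_schedule xs) n \<and>
           n \<le> poly p (size (enc_psba I)) \<and>
           complete_schedule I (set xs) \<and>
           real (schedule_value I (set xs)) \<ge> \<rho> * real (opt_value I)))"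

end

theory Submission
  imports Defs
begin

text \<open>
  The largest number \<open>max_free J U\<close> of slots of \<open>U\<close> that a feasible schedule of \<open>J\<close> leaves free is
  the rank of \<open>U\<close> in the dual of a transversal matroid.  Hence the objective is monotone and
  submodular, and scheduling the events one after another, each with an \<open>\<alpha>\<close>-approximate
  marginal gain, loses a factor of \<open>\<alpha> + 1\<close>.  The marginal gain after occupying a set \<open>V\<close> of slots is
  the objective for the contraction by \<open>V\<close>, which is again given by job sets: a dummy job fills
  \<open>V\<close>, and the processing times of the other jobs are decreased, one job at a time, to the largest
  values satisfying Hall's condition.  As the allowed slots form intervals, Hall's condition has to
  be checked only for intervals from a release time to a deadline, so the number of slots, and
  with it \<open>|T|\<close>, enters the running time only through the length of its binary encoding.
\<close>

section \<open>Job schedules as matchings\<close>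

text \<open>The given algorithm can only be run on instances, so a marginal gain has to become an
  instance again. Contracting \<open>V\<close> in the dual matroid means deleting \<open>V\<close>
  from the transversal matroid, but a job interval with a hole is no interval. Hence the intervals
  are kept and a dummy job blocks \<open>V\<close>. The other jobs may then no longer fit; in total
  they are shrunk by exactly the number of units that every schedule is forced to put into
  \<open>V\<close>. Shrinking one job after another, in list order, reaches this total because the
  vectors of processing times that fit beside the dummy job form a polymatroid: all maximal ones
  below the original vector have the same sum. The exchange lemma for partial schedules carries this
  argument. Each event reserves a single interval, so reservations can be iterated. The ratio
  follows by induction from three facts about every instance: monotonicity, subadditivity and the
  contraction identity. What remains is the running time in a language without arithmetic.\<close>

definition partial_schedule :: "'i set \<Rightarrow> ('i \<Rightarrow> 's set) \<Rightarrow> ('i \<Rightarrow> nat) \<Rightarrow> ('i \<Rightarrow> 's set) \<Rightarrow> bool" where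
  "partial_schedule A R p \<sigma> \<longleftrightarrow>
     (\<forall>j\<in>A. \<sigma> j \<subseteq> R j \<and> card (\<sigma> j) \<le> p j) \<and> (\<forall>j\<in>A. \<forall>k\<in>A. j \<noteq> k \<longrightarrow> \<sigma> j \<inter> \<sigma> k = {})"

text \<open>A capacitated form of the Mendelsohn--Dulmage theorem.  Among all partial schedules that
  dominate \<open>\<sigma>1\<close>, one that overlaps \<open>\<sigma>2\<close> as much as possible covers all slots of \<open>\<sigma>2\<close>.\<close>

lemma partial_schedule_exchange:
  assumes A: "finite A" and R: "\<And>j. j \<in> A \<Longrightarrow> finite (R j)"
    and 1: "partial_schedule A R p \<sigma>1" and 2: "partial_schedule A R p \<sigma>2"
  obtains \<sigma> where "partial_schedule A R p \<sigma>" "\<And>j. j \<in> A \<Longrightarrow> card (\<sigma>1 j) \<le> card (\<sigma> j)"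
    "(\<Union>j\<in>A. \<sigma>2 j) \<subseteq> (\<Union>j\<in>A. \<sigma> j)"
proof -
  define P where "P = (\<lambda>\<sigma>. partial_schedule A R p \<sigma> \<and> (\<forall>j\<in>A. card (\<sigma>1 j) \<le> card (\<sigma> j)))"
  \<comment> \<open>Only slots with the same owner in both schedules count: a slot given up in the
    exchange may be covered by \<open>\<sigma>2\<close> for another job, and the count must grow
    nevertheless.\<close>
  define overlap where "overlap = (\<lambda>\<sigma>. \<Sum>j\<in>A. card (\<sigma> j \<inter> \<sigma>2 j))"
  have fin2: "finite (\<sigma>2 j)" if "j \<in> A" for j
    using 2 R that unfolding partial_schedule_def by (meson finite_subset)
  have "\<exists>\<sigma>. P \<sigma> \<and> (\<forall>\<tau>. P \<tau> \<longrightarrow> overlap \<tau> \<le> overlap \<sigma>)"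
  proof (rule ex_has_greatest_nat[where k = \<sigma>1])
    show "P \<sigma>1" using 1 by (simp add: P_def)
    have "overlap \<tau> \<le> (\<Sum>j\<in>A. card (\<sigma>2 j))" for \<tau>
      unfolding overlap_def by (intro sum_mono card_mono fin2) auto
    then show "\<forall>\<tau>. P \<tau> \<longrightarrow> overlap \<tau> < Suc (\<Sum>j\<in>A. card (\<sigma>2 j))"
      by (simp add: less_Suc_eq_le)
  qed
  then obtain \<sigma> where \<sigma>: "P \<sigma>" and max: "\<And>\<tau>. P \<tau> \<Longrightarrow> overlap \<tau> \<le> overlap \<sigma>" by blast
  have ps: "partial_schedule A R p \<sigma>" using \<sigma> P_def by simp
  have fin: "finite (\<sigma> j)" if "j \<in> A" for j
    using ps R that unfolding partial_schedule_def by (meson finite_subset)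
  have "(\<Union>j\<in>A. \<sigma>2 j) \<subseteq> (\<Union>j\<in>A. \<sigma> j)"
  proof (rule ccontr)
    assume "\<not> ?thesis"
    then obtain j s where j: "j \<in> A" and s: "s \<in> \<sigma>2 j" and free: "\<And>k. k \<in> A \<Longrightarrow> s \<notin> \<sigma> k"
      by blast
    have cap: "card (\<sigma>2 j) \<le> p j" "card (\<sigma> j) \<le> p j" and sR: "s \<in> R j"
      using 2 ps j s unfolding partial_schedule_def by auto
    \<comment> \<open>\<open>X\<close> is what \<open>j\<close> keeps to make room for
      \<open>s\<close>: everything if capacity is left, otherwise all but one slot that is not in
      \<open>\<sigma>2 j\<close>.\<close>
    obtain X where X: "X \<subseteq> \<sigma> j" "\<sigma> j \<inter> \<sigma>2 j \<subseteq> X" "card X < p j" "card (\<sigma> j) \<le> Suc (card X)"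
    proof (cases "card (\<sigma> j) < p j")
      case True
      then show ?thesis using that[of "\<sigma> j"] by auto
    next
      case False
      \<comment> \<open>A full \<open>\<sigma> j\<close> inside \<open>\<sigma>2 j\<close> would
        equal it by cardinality, but \<open>s\<close> lies only in the latter.\<close>
      have "\<not> \<sigma> j \<subseteq> \<sigma>2 j"
        using False cap card_seteq[OF fin2[OF j], of "\<sigma> j"] s free[OF j] by auto
      then obtain s' where s': "s' \<in> \<sigma> j" "s' \<notin> \<sigma>2 j" by blast
      then have "Suc (card (\<sigma> j - {s'})) = card (\<sigma> j)"
        using card_Suc_Diff1[OF fin[OF j]] by simp
      then have "card (\<sigma> j - {s'}) < p j" "card (\<sigma> j) \<le> Suc (card (\<sigma> j - {s'}))"
        using cap(2) by linarith+
      moreover have "\<sigma> j - {s'} \<subseteq> \<sigma> j" "\<sigma> j \<inter> \<sigma>2 j \<subseteq> \<sigma> j - {s'}" using s' by blast+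
      ultimately show ?thesis using that by blast
    qed
    have finX: "finite X" and sX: "s \<notin> X" using X(1) fin[OF j] free[OF j] finite_subset by auto
    define \<tau> where "\<tau> = \<sigma>(j := insert s X)"
    have "P \<tau>"
      unfolding P_def
    proof
      show "partial_schedule A R p \<tau>"
        unfolding partial_schedule_def
      proof (intro conjI ballI impI)
        fix k assume k: "k \<in> A"
        show "\<tau> k \<subseteq> R k"
          using ps k X(1) sR unfolding partial_schedule_def \<tau>_def by auto
        show "card (\<tau> k) \<le> p k"
          using ps k X(3) sX finX unfolding partial_schedule_def \<tau>_def by auto
        fix i assume "i \<in> A" "k \<noteq> i"
        then show "\<tau> k \<inter> \<tau> i = {}"
          using ps k X(1) free[of k] free[of i] j unfolding partial_schedule_def \<tau>_def
          by (cases "k = j"; cases "i = j") (simp_all, blast+)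
      qed
      show "\<forall>k\<in>A. card (\<sigma>1 k) \<le> card (\<tau> k)"
        using \<sigma> X(4) finX sX unfolding P_def \<tau>_def by fastforce
    qed
    moreover have "overlap \<sigma> < overlap \<tau>"
      unfolding overlap_def
    proof (rule sum_strict_mono_ex1[OF A])
      have sub: "\<sigma> j \<inter> \<sigma>2 j \<subset> \<tau> j \<inter> \<sigma>2 j"
        using X(2) s free[OF j] unfolding \<tau>_def by auto
      then have less: "card (\<sigma> j \<inter> \<sigma>2 j) < card (\<tau> j \<inter> \<sigma>2 j)"
        by (rule psubset_card_mono[rotated]) (simp add: fin2[OF j])
      then show "\<exists>k\<in>A. card (\<sigma> k \<inter> \<sigma>2 k) < card (\<tau> k \<inter> \<sigma>2 k)" using j by blast
      show "\<forall>k\<in>A. card (\<sigma> k \<inter> \<sigma>2 k) \<le> card (\<tau> k \<inter> \<sigma>2 k)"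
        using less by (auto simp: \<tau>_def)
    qed
    ultimately show False using max by (simp add: leD)
  qed
  then show ?thesis using that[of \<sigma>] \<sigma> ps by (auto simp: P_def)
qed

text \<open>Earliest deadline first: the earliest released unit with the smallest deadline is placed in
  its first slot, which no other job needs afterwards.\<close>

lemma interval_Hall:
  fixes r d p :: "'i \<Rightarrow> nat"
  assumes "finite A" "\<And>a b. (\<Sum>j | j \<in> A \<and> a \<le> r j \<and> d j \<le> b. p j) \<le> b + 1 - a"
  shows "\<exists>\<sigma>. (\<forall>j\<in>A. \<sigma> j \<subseteq> {r j..d j} \<and> card (\<sigma> j) = p j) \<and>
    (\<forall>j\<in>A. \<forall>k\<in>A. j \<noteq> k \<longrightarrow> \<sigma> j \<inter> \<sigma> k = {})"
  using assms
proof (induction "\<Sum>j\<in>A. p j" arbitrary: r p)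
  case 0
  then show ?case by (intro exI[of _ "\<lambda>_. {}"]) auto
next
  case (Suc n)
  have fin: "finite {j \<in> A. Q j}" for Q using Suc.prems(1) by simp
  define B where "B = {j \<in> A. 0 < p j}"
  have "B \<noteq> {}" using Suc.hyps(2) unfolding B_def by fastforce
  define t where "t = Min (r ` B)"
  have tmin: "t \<le> r j" if "j \<in> B" for j
    using that Suc.prems(1) unfolding t_def B_def by simp
  have "t \<in> r ` B" unfolding t_def using \<open>B \<noteq> {}\<close> Suc.prems(1) by (intro Min_in) (auto simp: B_def)
  then have "{j \<in> B. r j = t} \<noteq> {}" by auto
  moreover have "finite {j \<in> B. r j = t}" using Suc.prems(1) by (simp add: B_def)
  ultimately obtain j where j: "j \<in> {j \<in> B. r j = t}"
    and jmin: "\<And>k. k \<in> {j \<in> B. r j = t} \<Longrightarrow> d j \<le> d k"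
    using ex_is_arg_min_if_finite[of "{j \<in> B. r j = t}" d] unfolding is_arg_min_linorder by blast
  have jA: "j \<in> A" and pj: "p j > 0" and rj: "r j = t" using j by (auto simp: B_def)
  define r' where "r' = (\<lambda>k. max (r k) (Suc t))"
  define p' where "p' = p(j := p j - 1)"
  have sum_p: "(\<Sum>k\<in>C. p k) = (if j \<in> C then 1 else 0) + (\<Sum>k\<in>C. p' k)" if "C \<subseteq> A" for C
  proof -
    have "finite C" using that Suc.prems(1) finite_subset by blast
    then show ?thesis using pj
      by (cases "j \<in> C") (auto simp: p'_def sum.remove[of C j] intro!: sum.cong)
  qed
  \<comment> \<open>By truncated subtraction, Hall's condition excludes positive demand in an empty
    window.\<close>
  have dj: "t \<le> d j"
  proof -
    have "p j \<le> (\<Sum>k | k \<in> A \<and> t \<le> r k \<and> d k \<le> d j. p k)"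
      using jA rj Suc.prems(1) by (intro member_le_sum) auto
    with Suc.prems(2)[of t "d j"] pj show ?thesis by linarith
  qed
  have "n = (\<Sum>k\<in>A. p' k)" using sum_p[of A] Suc.hyps(2) jA by simp
  moreover have "(\<Sum>k | k \<in> A \<and> a \<le> r' k \<and> d k \<le> b. p' k) \<le> b + 1 - a" for a b
  proof (cases "t < a")
    case False
    \<comment> \<open>Raising the release times lets only jobs released before \<open>t\<close>
      enter this window, and by the choice of \<open>t\<close> they have no work.\<close>
    have "(\<Sum>k | k \<in> A \<and> a \<le> r' k \<and> d k \<le> b. p' k) = (\<Sum>k | k \<in> A \<and> a \<le> r k \<and> d k \<le> b. p' k)"
    proof (intro sum.mono_neutral_right fin ballI)
      fix k assume k: "k \<in> {k. k \<in> A \<and> a \<le> r' k \<and> d k \<le> b} - {k. k \<in> A \<and> a \<le> r k \<and> d k \<le> b}"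
      then have "k \<notin> B" using False tmin[of k] by auto
      then show "p' k = 0" using k by (auto simp: B_def p'_def)
    qed (auto simp: r'_def)
    also have "\<dots> \<le> (\<Sum>k | k \<in> A \<and> a \<le> r k \<and> d k \<le> b. p k)"
      by (intro sum_mono) (auto simp: p'_def)
    finally show ?thesis using Suc.prems(2)[of a b] by linarith
  next
    case True
    \<comment> \<open>Among jobs with work left, only those released at \<open>t\<close> can enter
      the window. If it reaches \<open>d j\<close>, extend it back to \<open>t\<close>: one slot
      more, but also one unit more, the one just placed. If it ends before \<open>d j\<close>, the
      choice of \<open>j\<close> leaves no such job. Windows starting later gain no job.\<close>
    consider "a = Suc t" "d j \<le> b" | "a = Suc t" "b < d j" | "Suc t < a" using True by linarith
    then show ?thesis
    proof cases
      case 1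
      have "(\<Sum>k | k \<in> A \<and> a \<le> r' k \<and> d k \<le> b. p' k) = (\<Sum>k | k \<in> A \<and> t \<le> r k \<and> d k \<le> b. p' k)"
        using 1 tmin Suc.prems(1)
        by (intro sum.mono_neutral_right fin) (auto simp: r'_def p'_def B_def split: if_splits)
      also have "Suc \<dots> = (\<Sum>k | k \<in> A \<and> t \<le> r k \<and> d k \<le> b. p k)"
        using sum_p[of "{k. k \<in> A \<and> t \<le> r k \<and> d k \<le> b}"] jA rj 1 by auto
      also have "\<dots> \<le> b + 1 - t" by (rule Suc.prems(2))
      finally show ?thesis using 1 by linarith
    next
      case 2
      have "(\<Sum>k | k \<in> A \<and> a \<le> r' k \<and> d k \<le> b. p' k) = (\<Sum>k | k \<in> A \<and> a \<le> r k \<and> d k \<le> b. p' k)"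
      proof (intro sum.mono_neutral_right fin ballI)
        fix k assume k: "k \<in> {k. k \<in> A \<and> a \<le> r' k \<and> d k \<le> b} - {k. k \<in> A \<and> a \<le> r k \<and> d k \<le> b}"
        show "p' k = 0"
        proof (rule ccontr)
          assume "p' k \<noteq> 0"
          then have "k \<in> B" using k by (auto simp: B_def p'_def split: if_splits)
          moreover from this k 2 have "r k = t" using tmin[of k] by auto
          ultimately show False using jmin[of k] k 2 by auto
        qed
      qed (auto simp: r'_def)
      also have "\<dots> \<le> (\<Sum>k | k \<in> A \<and> a \<le> r k \<and> d k \<le> b. p k)"
        by (intro sum_mono) (auto simp: p'_def)
      also have "\<dots> \<le> b + 1 - a" by (rule Suc.prems(2))
      finally show ?thesis .
    next
      case 3
      then have eq: "{k. k \<in> A \<and> a \<le> r' k \<and> d k \<le> b} = {k. k \<in> A \<and> a \<le> r k \<and> d k \<le> b}"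
        by (auto simp: r'_def)
      have "(\<Sum>k | k \<in> A \<and> a \<le> r' k \<and> d k \<le> b. p' k) \<le> (\<Sum>k | k \<in> A \<and> a \<le> r k \<and> d k \<le> b. p k)"
        unfolding eq by (intro sum_mono) (auto simp: p'_def)
      then show ?thesis using Suc.prems(2)[of a b] by linarith
    qed
  qed
  ultimately obtain \<sigma> where \<sigma>: "\<And>k. k \<in> A \<Longrightarrow> \<sigma> k \<subseteq> {r' k..d k}" "\<And>k. k \<in> A \<Longrightarrow> card (\<sigma> k) = p' k"
      "\<And>i k. i \<in> A \<Longrightarrow> k \<in> A \<Longrightarrow> i \<noteq> k \<Longrightarrow> \<sigma> i \<inter> \<sigma> k = {}"
    using Suc.hyps(1)[of p' r'] Suc.prems(1) by metis
  have t: "t \<notin> \<sigma> k" if "k \<in> A" for k using \<sigma>(1)[OF that] by (auto simp: r'_def)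
  have "\<sigma> j \<subseteq> {r j..d j}" "finite (\<sigma> j)"
    using \<sigma>(1)[OF jA] by (auto simp: r'_def finite_subset[OF _ finite_atLeastAtMost])
  then have "card (insert t (\<sigma> j)) = p j" "insert t (\<sigma> j) \<subseteq> {r j..d j}"
    using t[OF jA] \<sigma>(2)[OF jA] pj rj dj by (auto simp: p'_def)
  moreover have "\<sigma> k \<subseteq> {r k..d k}" "k \<noteq> j \<Longrightarrow> card (\<sigma> k) = p k" if "k \<in> A" for k
    using \<sigma>(1,2)[OF that] by (auto simp: r'_def p'_def)
  ultimately show ?case
    using \<sigma>(3) t jA by (intro exI[of _ "\<sigma>(j := insert t (\<sigma> j))"]) auto
qed

section \<open>Reserving an interval\<close>

definition demand :: "job list \<Rightarrow> nat \<Rightarrow> nat \<Rightarrow> nat" where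
  "demand K a b = sum_list (map proc (filter (\<lambda>k. a \<le> release k \<and> deadline k \<le> b) K))"

text \<open>For \<open>a \<ge> 1\<close> the start value is the number of slots in
  \<open>{a..b}\<close>. Start value and fold use subtraction only, and no intermediate value
  exceeds \<open>b\<close>, which later bounds the sizes in the program.\<close>

definition slack :: "job list \<Rightarrow> nat \<Rightarrow> nat \<Rightarrow> nat" where
  "slack K a b = foldl (\<lambda>s k. if a \<le> release k \<and> deadline k \<le> b then s - proc k else s) (b - (a - 1)) K"

text \<open>Nested folds instead of a minimum over a set, because this is the form that a program
  executes; \<open>max_proc_eq\<close> restores the set. Only windows that contain the interval of
  \<open>j\<close> can limit it.\<close>

definition max_proc :: "job \<Rightarrow> job list \<Rightarrow> nat" where
  "max_proc j K = foldl (\<lambda>m x. foldl (\<lambda>m y.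
       if release x \<le> release j \<and> deadline j \<le> deadline y
       then min m (slack K (release x) (deadline y)) else m) m (j # K)) (proc j) (j # K)"

definition shrink :: "job \<Rightarrow> job list \<Rightarrow> job" where
  "shrink j K = \<lparr>release = release j, deadline = deadline j, proc = max_proc j K\<rparr>"

text \<open>Starting the fold with \<open>[d]\<close> puts the dummy job last, so every other job
  keeps its index and is shrunk against \<open>d\<close> and the already shrunk jobs behind
  it.\<close>

definition reserve :: "job \<Rightarrow> job list \<Rightarrow> job list" where
  "reserve d J = foldr (\<lambda>j K. shrink j K # K) J [d]"

lemma release_shrink [simp]: "release (shrink j K) = release j"
  and deadline_shrink [simp]: "deadline (shrink j K) = deadline j"
  and proc_shrink [simp]: "proc (shrink j K) = max_proc j K"
  by (simp_all add: shrink_def)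

lemma job_interval_shrink [simp]: "job_interval (shrink j K) = job_interval j"
  by (simp add: job_interval_def)

lemma reserve_Nil [simp]: "reserve d [] = [d]"
  and reserve_Cons [simp]: "reserve d (j # J) = shrink j (reserve d J) # reserve d J"
  by (simp_all add: reserve_def)

lemma demand_Nil [simp]: "demand [] a b = 0"
  and demand_Cons [simp]: "demand (k # K) a b =
    (if a \<le> release k \<and> deadline k \<le> b then proc k else 0) + demand K a b"
  by (simp_all add: demand_def)

lemma foldl_diff_eq:
  "foldl (\<lambda>s k. if P k then s - f k else s) (s::nat) K = s - sum_list (map f (filter P K))"
  by (induction K arbitrary: s) auto

lemma slack_eq: "slack K a b = b - (a - 1) - demand K a b"
  by (simp add: slack_def demand_def foldl_diff_eq)

lemma foldl_Min_insert:
  fixes m :: "'a :: linorder"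
  assumes "\<And>x. finite (S x)"
  shows "foldl (\<lambda>m x. Min (insert m (S x))) m xs = Min (insert m (\<Union>x\<in>set xs. S x))"
proof (induction xs arbitrary: m)
  case (Cons x xs)
  have fin: "finite (\<Union>x\<in>set xs. S x)" using assms by blast
  have "Min (insert (Min (insert m (S x))) (\<Union>x\<in>set xs. S x)) =
    Min (insert m (S x) \<union> (\<Union>x\<in>set xs. S x))"
  proof (cases "(\<Union>x\<in>set xs. S x) = {}")
    case True
    then show ?thesis by simp
  next
    case False
    then show ?thesis using fin assms by (subst Min_Un) auto
  qed
  then show ?case by (simp add: Cons.IH Un_assoc)
qed simp

lemma max_proc_eq:
  "max_proc j K = Min (insert (proc j) {slack K (release x) (deadline y) | x y.
     x \<in> set (j # K) \<and> y \<in> set (j # K) \<and> release x \<le> release j \<and> deadline j \<le> deadline y})"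
proof -
  let ?S = "\<lambda>x y. if release x \<le> release j \<and> deadline j \<le> deadline y
    then {slack K (release x) (deadline y)} else {}"
  have "max_proc j K = foldl (\<lambda>m x. foldl (\<lambda>m y. Min (insert m (?S x y))) m (j # K)) (proc j) (j # K)"
    unfolding max_proc_def by (intro foldl_cong refl) simp
  also have "\<dots> = foldl (\<lambda>m x. Min (insert m (\<Union>y\<in>set (j # K). ?S x y))) (proc j) (j # K)"
    by (subst foldl_Min_insert) auto
  also have "\<dots> = Min (insert (proc j) (\<Union>x\<in>set (j # K). \<Union>y\<in>set (j # K). ?S x y))"
    by (rule foldl_Min_insert) auto
  also have "(\<Union>x\<in>set (j # K). \<Union>y\<in>set (j # K). ?S x y) = {slack K (release x) (deadline y) | x y.
     x \<in> set (j # K) \<and> y \<in> set (j # K) \<and> release x \<le> release j \<and> deadline j \<le> deadline y}"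
    by (auto split: if_splits)
  finally show ?thesis .
qed

lemma finite_slacks: "finite {slack K (release x) (deadline y) | x y.
     x \<in> set (j # K) \<and> y \<in> set (j # K) \<and> release x \<le> release j \<and> deadline j \<le> deadline y}"
  by (rule finite_subset[of _ "(\<lambda>(x, y). slack K (release x) (deadline y)) ` (set (j # K) \<times> set (j # K))"])
     auto

lemma max_proc_le: "max_proc j K \<le> proc j"
  unfolding max_proc_eq using finite_slacks by (intro Min_le) auto

lemma max_proc_le_slack:
  assumes "x \<in> set (j # K)" "y \<in> set (j # K)" "release x \<le> release j" "deadline j \<le> deadline y"
  shows "max_proc j K \<le> slack K (release x) (deadline y)"
  unfolding max_proc_eq using finite_slacks assms by (intro Min_le) auto

lemma max_proc_tight:
  assumes "max_proc j K \<noteq> proc j"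
  obtains x y where "x \<in> set (j # K)" "y \<in> set (j # K)" "release x \<le> release j" "deadline j \<le> deadline y"
    "max_proc j K = slack K (release x) (deadline y)"
proof -
  have "max_proc j K \<in> insert (proc j) {slack K (release x) (deadline y) | x y.
     x \<in> set (j # K) \<and> y \<in> set (j # K) \<and> release x \<le> release j \<and> deadline j \<le> deadline y}"
    unfolding max_proc_eq using finite_slacks by (intro Min_in) auto
  with assms that show ?thesis by auto
qed

section \<open>Hall's condition for jobs with interval windows\<close>

definition Hall :: "job list \<Rightarrow> bool" where
  "Hall K \<longleftrightarrow> (\<forall>a b. demand K a b \<le> b + 1 - a)"

text \<open>A window may be narrowed to the earliest release time and the latest deadline of the
  jobs inside it: the demand stays and the number of slots does not grow.\<close>

lemma HallI:
  assumes "\<And>x y. x \<in> set K \<Longrightarrow> y \<in> set K \<Longrightarrow>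
    demand K (release x) (deadline y) \<le> deadline y + 1 - release x"
  shows "Hall K"
  unfolding Hall_def
proof (intro allI)
  fix a b
  define X where "X = {k \<in> set K. a \<le> release k \<and> deadline k \<le> b}"
  have fin: "finite X" by (simp add: X_def)
  show "demand K a b \<le> b + 1 - a"
  proof (cases "X = {}")
    case True
    then have "filter (\<lambda>k. a \<le> release k \<and> deadline k \<le> b) K = []"
      by (auto simp: X_def filter_empty_conv)
    then have "demand K a b = 0" by (simp add: demand_def)
    then show ?thesis by simp
  next
    case False
    obtain x where x: "x \<in> X" "\<And>k. k \<in> X \<Longrightarrow> release x \<le> release k"
      using ex_is_arg_min_if_finite[OF fin False, of release] unfolding is_arg_min_linorder by blast
    have "Max (deadline ` X) \<in> deadline ` X" using fin False by simp
    then obtain y where y: "y \<in> X" "deadline y = Max (deadline ` X)" by force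
    then have y': "deadline k \<le> deadline y" if "k \<in> X" for k using fin that by simp
    have "filter (\<lambda>k. a \<le> release k \<and> deadline k \<le> b) K =
        filter (\<lambda>k. release x \<le> release k \<and> deadline k \<le> deadline y) K"
      using x y(1) y' by (intro filter_cong refl) (fastforce simp: X_def)
    then have "demand K a b = demand K (release x) (deadline y)" by (simp add: demand_def)
    also have "\<dots> \<le> deadline y + 1 - release x" using assms x(1) y(1) by (simp add: X_def)
    also have "\<dots> \<le> b + 1 - a" using x(1) y(1) by (auto simp: X_def)
    finally show ?thesis .
  qed
qed

text \<open>Windows that do not contain the interval of \<open>j\<close> keep their demand. The
  shrunk job has the endpoints of \<open>j\<close>, so every other window of \<open>HallI\<close> is
  one whose slack bounds \<open>max_proc\<close>.\<close>

lemma Hall_shrink: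
  assumes "Hall K" "\<And>k. k \<in> set (j # K) \<Longrightarrow> 1 \<le> release k"
  shows "Hall (shrink j K # K)"
proof (rule HallI)
  fix x y assume "x \<in> set (shrink j K # K)" "y \<in> set (shrink j K # K)"
  then have "\<exists>x'\<in>set (j # K). release x = release x'" "\<exists>y'\<in>set (j # K). deadline y = deadline y'"
    by auto
  then obtain x' y' where x: "x' \<in> set (j # K)" "release x = release x'"
    and y: "y' \<in> set (j # K)" "deadline y = deadline y'" by blast
  have "demand K (release x') (deadline y') \<le> deadline y' + 1 - release x'"
    using assms(1) by (simp add: Hall_def)
  moreover have "max_proc j K \<le> deadline y' - (release x' - 1) - demand K (release x') (deadline y')"
    if "release x' \<le> release j" "deadline j \<le> deadline y'"
    using max_proc_le_slack[OF x(1) y(1) that] by (simp add: slack_eq)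
  ultimately show "demand (shrink j K # K) (release x) (deadline y) \<le> deadline y + 1 - release x"
    using assms(2)[OF x(1)] x y by auto
qed

lemma demand_eq_sum:
  "demand K a b = (\<Sum>i | i < length K \<and> a \<le> release (K ! i) \<and> deadline (K ! i) \<le> b. proc (K ! i))"
proof -
  have "demand K a b = sum_list (map (\<lambda>k. if a \<le> release k \<and> deadline k \<le> b then proc k else 0) K)"
    by (induction K) auto
  also have "\<dots> = (\<Sum>i<length K. if a \<le> release (K ! i) \<and> deadline (K ! i) \<le> b then proc (K ! i) else 0)"
    by (simp add: sum_list_sum_nth atLeast0LessThan)
  also have "\<dots> = (\<Sum>i | i < length K \<and> a \<le> release (K ! i) \<and> deadline (K ! i) \<le> b. proc (K ! i))"
    by (simp add: sum.inter_filter[symmetric])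
  finally show ?thesis .
qed

lemma Hall_feasible:
  assumes "Hall K"
  shows "\<exists>\<sigma>. feasible_job_schedule K \<sigma>"
proof -
  have "(\<Sum>j | j \<in> {..<length K} \<and> a \<le> release (K ! j) \<and> deadline (K ! j) \<le> b. proc (K ! j)) \<le> b + 1 - a" for a b
    using assms by (simp add: Hall_def demand_eq_sum)
  from interval_Hall[OF _ this] show ?thesis
    unfolding feasible_job_schedule_def job_interval_def by (simp add: Ball_def)
qed

text \<open>A job without any freedom: it fills its interval in every feasible schedule and thereby
  reserves it.\<close>

definition block_job :: "job \<Rightarrow> bool" where
  "block_job d \<longleftrightarrow> 1 \<le> release d \<and> release d \<le> deadline d \<and> proc d = card (job_interval d)"

lemma length_reserve [simp]: "length (reserve d J) = Suc (length J)"
  by (induction J) auto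

lemma reserve_nth_length [simp]: "reserve d J ! length J = d"
  by (induction J) auto

lemma reserve_nth:
  "i < length J \<Longrightarrow> reserve d J ! i = shrink (J ! i) (drop (Suc i) (reserve d J))"
proof (induction J arbitrary: i)
  case (Cons j J)
  then show ?case by (cases i) auto
qed simp

lemma reserve_release_pos:
  assumes "block_job d" "\<And>j. j \<in> set J \<Longrightarrow> 1 \<le> release j"
  shows "k \<in> set (reserve d J) \<Longrightarrow> 1 \<le> release k"
  using assms by (induction J) (auto simp: block_job_def)

lemma Hall_reserve:
  assumes "block_job d" "\<And>j. j \<in> set J \<Longrightarrow> 1 \<le> release j"
  shows "Hall (reserve d J)"
  using assms
proof (induction J)
  case Nil
  then show ?case by (intro HallI) (auto simp: block_job_def job_interval_def)
next
  case (Cons j J)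
  then show ?case unfolding reserve_Cons
    using reserve_release_pos[OF Cons.prems(1), of J] by (intro Hall_shrink) auto
qed

lemma demand_drop:
  assumes "i < length K"
  shows "demand (drop (Suc i) K) a b =
    (\<Sum>k | i < k \<and> k < length K \<and> a \<le> release (K ! k) \<and> deadline (K ! k) \<le> b. proc (K ! k))"
  unfolding demand_eq_sum using assms
  by (intro sum.reindex_bij_witness[of _ "\<lambda>k. k - Suc i" "\<lambda>k. Suc i + k"]) auto

text \<open>No job of \<open>reserve d J\<close> other than \<open>d\<close> can be given more slots outside the interval of \<open>d\<close>,
  since the job is contained in an interval that is already full.\<close>

lemma reserve_covers:
  assumes d: "block_job d" and pos: "\<And>j. j \<in> set J \<Longrightarrow> 1 \<le> release j"
    and \<tau>: "partial_schedule {..<length J} (\<lambda>i. job_interval (J ! i) - job_interval d) (\<lambda>i. proc (J ! i)) \<tau>"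
  obtains \<sigma> where "feasible_job_schedule (reserve d J) \<sigma>" "(\<Union>i<length J. \<tau> i) \<subseteq> (\<Union>i<length J. \<sigma> i)"
proof -
  let ?n = "length J" and ?K = "reserve d J"
  define R where "R = (\<lambda>i. job_interval (?K ! i))"
  \<comment> \<open>The capacities are the original processing times, because \<open>\<tau>\<close>
    need not respect the shrunk ones. That the schedule obtained does respect them is derived
    afterwards from tight windows.\<close>
  define p where "p = (\<lambda>i. proc ((J @ [d]) ! i))"
  have R: "R i = job_interval (J ! i)" if "i < ?n" for i
    using that by (simp add: R_def reserve_nth)
  have Rn: "R ?n = job_interval d" by (simp add: R_def)
  have Kp: "proc (?K ! i) \<le> p i" if "i \<le> ?n" for i
    using that max_proc_le by (cases "i = ?n") (auto simp: p_def reserve_nth nth_append)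
  have finR: "finite (R i)" for i by (simp add: R_def job_interval_def)
  obtain \<sigma>1 where \<sigma>1: "feasible_job_schedule ?K \<sigma>1" using Hall_feasible[OF Hall_reserve[OF d pos]] by blast
  have 1: "partial_schedule {..?n} R p \<sigma>1"
    using \<sigma>1 Kp unfolding partial_schedule_def feasible_job_schedule_def R_def by (auto simp: less_Suc_eq_le)
  define \<sigma>2 where "\<sigma>2 = \<tau>(?n := job_interval d)"
  have 2: "partial_schedule {..?n} R p \<sigma>2"
    unfolding partial_schedule_def
  proof (intro conjI ballI impI)
    fix i assume i: "i \<in> {..?n}"
    show "\<sigma>2 i \<subseteq> R i" "card (\<sigma>2 i) \<le> p i"
      using \<tau> d i R[of i] Rn unfolding partial_schedule_def \<sigma>2_def p_def block_job_def
      by (cases "i = ?n"; force simp: nth_append)+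
    fix k assume "k \<in> {..?n}" "i \<noteq> k"
    then show "\<sigma>2 i \<inter> \<sigma>2 k = {}"
      using \<tau> i unfolding partial_schedule_def \<sigma>2_def by (cases "i = ?n"; cases "k = ?n") force+
  qed
  obtain \<sigma> where ps: "partial_schedule {..?n} R p \<sigma>"
    and ge: "\<And>j. j \<in> {..?n} \<Longrightarrow> card (\<sigma>1 j) \<le> card (\<sigma> j)"
    and cover: "(\<Union>j\<in>{..?n}. \<sigma>2 j) \<subseteq> (\<Union>j\<in>{..?n}. \<sigma> j)"
    using partial_schedule_exchange[OF _ _ 1 2] finR by blast
  have sub: "\<sigma> i \<subseteq> R i" if "i \<le> ?n" for i using ps that by (simp add: partial_schedule_def)
  have fin: "finite (\<sigma> i)" if "i \<le> ?n" for i using sub[OF that] finR finite_subset by blast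
  have disj: "\<sigma> i \<inter> \<sigma> k = {}" if "i \<le> ?n" "k \<le> ?n" "i \<noteq> k" for i k
    using ps that by (simp add: partial_schedule_def)
  have ge': "proc (?K ! i) \<le> card (\<sigma> i)" if "i \<le> ?n" for i
    using ge[of i] \<sigma>1 that by (auto simp: feasible_job_schedule_def)
  have eq: "card (\<sigma> i) = proc (?K ! i)" if i: "i \<le> ?n" for i
  proof (rule ccontr)
    assume neq: "card (\<sigma> i) \<noteq> proc (?K ! i)"
    with ge'[OF i] have gt: "proc (?K ! i) < card (\<sigma> i)" by simp
    moreover have "card (\<sigma> i) \<le> p i" using ps i by (simp add: partial_schedule_def)
    ultimately have lt: "proc (?K ! i) < p i" by simp
    then have i': "i < ?n" using i by (cases "i = ?n") (auto simp: p_def)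
    let ?D = "drop (Suc i) ?K"
    have Ki: "?K ! i = shrink (J ! i) ?D" using reserve_nth[OF i'] .
    with lt i' have "max_proc (J ! i) ?D \<noteq> proc (J ! i)" by (simp add: p_def nth_append)
    then obtain x y :: job where x: "x \<in> set (J ! i # ?D)" "release x \<le> release (J ! i)"
      and y: "deadline (J ! i) \<le> deadline y"
      and tight: "max_proc (J ! i) ?D = slack ?D (release x) (deadline y)"
      using max_proc_tight by blast
    define a b where "a = release x" and "b = deadline y"
    \<comment> \<open>For \<open>a = 0\<close> the start value of \<open>slack\<close> would be one
      less than the number of slots.\<close>
    have "1 \<le> a" using x(1) pos i' reserve_release_pos[OF d pos] by (auto simp: a_def dest: in_set_dropD)
    \<comment> \<open>\<open>C\<close> collects the later jobs inside the tight window. Their shrunk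
      processing times and that of job \<open>i\<close> already amount to all slots of
      \<open>{a..b}\<close>, so a further unit of job \<open>i\<close> does not fit.\<close>
    define C where "C = {k. i < k \<and> k < Suc ?n \<and> a \<le> release (?K ! k) \<and> deadline (?K ! k) \<le> b}"
    have C: "k \<le> ?n" if "k \<in> C" for k using that by (auto simp: C_def)
    have finC: "finite C" by (rule finite_subset[of _ "{..?n}"]) (auto simp: C_def)
    have "b + 1 - a \<le> proc (?K ! i) + demand ?D a b"
      using tight \<open>1 \<le> a\<close> unfolding Ki a_def b_def by (simp add: slack_eq)
    also have "\<dots> = proc (?K ! i) + (\<Sum>k\<in>C. proc (?K ! k))"
      using i by (subst demand_drop) (auto simp: C_def)
    also have "\<dots> < card (\<sigma> i) + (\<Sum>k\<in>C. card (\<sigma> k))"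
      using gt ge' C by (intro add_less_le_mono sum_mono) auto
    also have "\<dots> = (\<Sum>k\<in>insert i C. card (\<sigma> k))" using finC by (simp add: C_def)
    also have "\<dots> = card (\<Union>k\<in>insert i C. \<sigma> k)"
      using finC i C fin disj by (intro card_UN_disjoint[symmetric]) (auto simp del: UN_insert)
    also have "\<dots> \<le> card {a..b}"
    proof (rule card_mono)
      have "R i \<subseteq> {a..b}" using R[OF i'] x(2) y by (auto simp: a_def b_def job_interval_def)
      moreover have "R k \<subseteq> {a..b}" if "k \<in> C" for k
        using that by (auto simp: R_def C_def job_interval_def)
      ultimately show "(\<Union>k\<in>insert i C. \<sigma> k) \<subseteq> {a..b}" using sub i C by blast
    qed simp
    also have "\<dots> = b + 1 - a" by simp
    finally show False by simp
  qed
  have "\<sigma> ?n = job_interval d"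
    using eq[of ?n] sub[of ?n] Rn d finR[of ?n] by (simp add: block_job_def card_subset_eq)
  show ?thesis
  proof (rule that)
    show "feasible_job_schedule ?K \<sigma>"
      using sub eq disj unfolding feasible_job_schedule_def R_def by (auto simp: less_Suc_eq_le)
    show "(\<Union>i<?n. \<tau> i) \<subseteq> (\<Union>i<?n. \<sigma> i)"
    proof
      fix s assume "s \<in> (\<Union>i<?n. \<tau> i)"
      then obtain i where i: "i < ?n" "s \<in> \<tau> i" by auto
      then have "s \<in> (\<Union>i\<in>{..?n}. \<sigma>2 i)" by (auto simp: \<sigma>2_def intro!: bexI[of _ i])
      then obtain k where k: "k \<le> ?n" "s \<in> \<sigma> k" using cover by blast
      have "s \<notin> job_interval d" using \<tau> i by (auto simp: partial_schedule_def)
      then have "k \<noteq> ?n" using k \<open>\<sigma> ?n = job_interval d\<close> by auto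
      with k show "s \<in> (\<Union>i<?n. \<sigma> i)" by auto
    qed
  qed
qed

text \<open>Exchange with a feasible schedule: the result gives every job at least, and by its
  capacity at most, the required number of slots. Covered slots stay covered, possibly by other
  jobs.\<close>

lemma partial_schedule_extend:
  assumes feas: "feasible_job_schedule J \<sigma>0"
    and \<tau>: "partial_schedule {..<length J} (\<lambda>i. job_interval (J ! i)) (\<lambda>i. proc (J ! i)) \<tau>"
  obtains \<sigma> where "feasible_job_schedule J \<sigma>" "(\<Union>i<length J. \<tau> i) \<subseteq> (\<Union>i<length J. \<sigma> i)"
proof -
  have 1: "partial_schedule {..<length J} (\<lambda>i. job_interval (J ! i)) (\<lambda>i. proc (J ! i)) \<sigma>0"
    using feas by (auto simp: partial_schedule_def feasible_job_schedule_def)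
  obtain \<sigma> where ps: "partial_schedule {..<length J} (\<lambda>i. job_interval (J ! i)) (\<lambda>i. proc (J ! i)) \<sigma>"
    and ge: "\<And>j. j \<in> {..<length J} \<Longrightarrow> card (\<sigma>0 j) \<le> card (\<sigma> j)"
    and cover: "(\<Union>j<length J. \<tau> j) \<subseteq> (\<Union>j<length J. \<sigma> j)"
    using partial_schedule_exchange[OF _ _ 1 \<tau>] by (auto simp: job_interval_def)
  moreover have "feasible_job_schedule J \<sigma>"
    using ps ge feas unfolding partial_schedule_def feasible_job_schedule_def
    by (simp add: le_antisym)
  ultimately show ?thesis using that by blast
qed

section \<open>Free slots as a rank function\<close>

definition used :: "job list \<Rightarrow> (nat \<Rightarrow> nat set) \<Rightarrow> nat set" where
  "used J \<sigma> = (\<Union>j<length J. \<sigma> j)"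

definition max_free :: "job list \<Rightarrow> nat set \<Rightarrow> nat" where
  "max_free J U = Max {card (U - used J \<sigma>) | \<sigma>. feasible_job_schedule J \<sigma>}"

lemma max_free_ge:
  assumes "finite U" "feasible_job_schedule J \<sigma>"
  shows "card (U - used J \<sigma>) \<le> max_free J U"
  unfolding max_free_def using assms
  by (intro Max_ge) (auto intro!: finite_subset[of _ "{..card U}"] card_mono)

lemma max_free_obtain:
  assumes "finite U" "\<exists>\<sigma>. feasible_job_schedule J \<sigma>"
  obtains \<sigma> where "feasible_job_schedule J \<sigma>" "max_free J U = card (U - used J \<sigma>)"
proof -
  have "finite {card (U - used J \<sigma>) | \<sigma>. feasible_job_schedule J \<sigma>}"
    using assms(1) by (auto intro!: finite_subset[of _ "{..card U}"] card_mono)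
  then have "max_free J U \<in> {card (U - used J \<sigma>) | \<sigma>. feasible_job_schedule J \<sigma>}"
    unfolding max_free_def using assms(2) by (intro Max_in) auto
  with that show ?thesis by auto
qed

lemma max_free_mono:
  assumes "finite V" "U \<subseteq> V" "\<exists>\<sigma>. feasible_job_schedule J \<sigma>"
  shows "max_free J U \<le> max_free J V"
proof -
  obtain \<sigma> where \<sigma>: "feasible_job_schedule J \<sigma>" "max_free J U = card (U - used J \<sigma>)"
    using max_free_obtain[of U J] assms finite_subset by metis
  have "card (U - used J \<sigma>) \<le> card (V - used J \<sigma>)" using assms by (intro card_mono) auto
  with \<sigma> max_free_ge[OF assms(1) \<sigma>(1)] show ?thesis by linarith
qed

lemma max_free_Un:
  assumes "finite U" "finite V" "\<exists>\<sigma>. feasible_job_schedule J \<sigma>"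
  shows "max_free J (U \<union> V) \<le> max_free J U + max_free J V"
proof -
  obtain \<sigma> where \<sigma>: "feasible_job_schedule J \<sigma>" "max_free J (U \<union> V) = card (U \<union> V - used J \<sigma>)"
    using max_free_obtain[of "U \<union> V" J] assms by auto
  have "card (U \<union> V - used J \<sigma>) \<le> card (U - used J \<sigma>) + card (V - used J \<sigma>)"
    unfolding Un_Diff by (rule card_Un_le)
  with \<sigma> max_free_ge[OF assms(1) \<sigma>(1)] max_free_ge[OF assms(2) \<sigma>(1)] show ?thesis by linarith
qed

lemma finite_feasible: "feasible_job_schedule J \<sigma> \<Longrightarrow> j < length J \<Longrightarrow> finite (\<sigma> j)"
  unfolding feasible_job_schedule_def job_interval_def by (meson finite_atLeastAtMost finite_subset)

text \<open>All feasible schedules use equally many slots, as bases of a matroid do; through this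
  count, inclusions between used sets become equalities.\<close>

lemma card_used:
  assumes "feasible_job_schedule J \<sigma>"
  shows "finite (used J \<sigma>)" "card (used J \<sigma>) = (\<Sum>j<length J. proc (J ! j))"
proof -
  note fin = finite_feasible[OF assms]
  then show "finite (used J \<sigma>)" by (simp add: used_def)
  have "card (used J \<sigma>) = (\<Sum>j<length J. card (\<sigma> j))"
    unfolding used_def using fin assms
    by (intro card_UN_disjoint) (auto simp: feasible_job_schedule_def)
  then show "card (used J \<sigma>) = (\<Sum>j<length J. proc (J ! j))"
    using assms by (simp add: feasible_job_schedule_def)
qed

text \<open>Since the capacities of \<open>partial_schedule\<close> are upper bounds, slots may be
  dropped: this passes from a schedule to its part outside a reserved set.\<close>

lemma feasible_partial_schedule:
  assumes "feasible_job_schedule J \<sigma>"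
  shows "partial_schedule {..<length J} (\<lambda>i. job_interval (J ! i) - V) (\<lambda>i. proc (J ! i)) (\<lambda>i. \<sigma> i - V)"
  unfolding partial_schedule_def
proof (intro conjI ballI impI)
  fix i assume i: "i \<in> {..<length J}"
  have "finite (\<sigma> i)" using finite_feasible[OF assms] i by simp
  then have "card (\<sigma> i - V) \<le> card (\<sigma> i)" by (intro card_mono) auto
  then show "card (\<sigma> i - V) \<le> proc (J ! i)" "\<sigma> i - V \<subseteq> job_interval (J ! i) - V"
    using assms i unfolding feasible_job_schedule_def by auto
  fix k assume "k \<in> {..<length J}" "i \<noteq> k"
  then show "(\<sigma> i - V) \<inter> (\<sigma> k - V) = {}"
    using assms i unfolding feasible_job_schedule_def by blast
qed

text \<open>\<open>used J \<sigma>\<close> reads only the length of \<open>J\<close>; for a schedule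
  of \<open>reserve d J\<close> it therefore consists of the slots of all jobs but \<open>d\<close>,
  which comes last.\<close>

lemma used_reserve:
  assumes "block_job d" "feasible_job_schedule (reserve d J) \<sigma>"
  shows "used (reserve d J) \<sigma> = job_interval d \<union> used J \<sigma>" "used J \<sigma> \<inter> job_interval d = {}"
    "finite (used J \<sigma>)" "card (used J \<sigma>) = (\<Sum>j<length J. proc (reserve d J ! j))"
proof -
  have "\<sigma> (length J) \<subseteq> job_interval d" "card (\<sigma> (length J)) = proc d"
    using assms(2) unfolding feasible_job_schedule_def
    by (metis length_reserve lessI reserve_nth_length)+
  then have n: "\<sigma> (length J) = job_interval d"
    using assms(1) by (intro card_subset_eq) (auto simp: block_job_def job_interval_def)
  then show eq: "used (reserve d J) \<sigma> = job_interval d \<union> used J \<sigma>"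
    by (simp add: used_def lessThan_Suc)
  show "used J \<sigma> \<inter> job_interval d = {}"
    using assms(2) n unfolding feasible_job_schedule_def used_def
    by (fastforce simp: less_Suc_eq)
  then have disj: "job_interval d \<inter> used J \<sigma> = {}" by blast
  show fin: "finite (used J \<sigma>)" using card_used(1)[OF assms(2)] eq by simp
  have "card (job_interval d \<union> used J \<sigma>) = (\<Sum>j<length J. proc (reserve d J ! j)) + proc d"
    using card_used(2)[OF assms(2)] unfolding eq by simp
  moreover have "card (job_interval d \<union> used J \<sigma>) = proc d + card (used J \<sigma>)"
    using disj fin assms(1) by (subst card_Un_disjoint) (auto simp: block_job_def job_interval_def)
  ultimately show "card (used J \<sigma>) = (\<Sum>j<length J. proc (reserve d J ! j))" by simp
qed

text \<open>The part of a base outside the reserved interval is independent after deletion of that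
  interval; the sets \<open>used J \<tau>\<close> play the role of the bases of the
  deletion.\<close>

lemma reserve_covers_free:
  assumes d: "block_job d" and pos: "\<And>j. j \<in> set J \<Longrightarrow> 1 \<le> release j"
    and \<sigma>: "feasible_job_schedule J \<sigma>"
  obtains \<tau> where "feasible_job_schedule (reserve d J) \<tau>" "used J \<sigma> - job_interval d \<subseteq> used J \<tau>"
proof -
  obtain \<tau> where \<tau>: "feasible_job_schedule (reserve d J) \<tau>"
      "(\<Union>i<length J. \<sigma> i - job_interval d) \<subseteq> (\<Union>i<length J. \<tau> i)"
    using reserve_covers[OF d pos feasible_partial_schedule[OF \<sigma>]] by blast
  with that show ?thesis unfolding used_def by blast
qed

text \<open>Reserving an interval \<open>V\<close> contracts \<open>V\<close> in the matroid whose rank function is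
  \<open>max_free J\<close>.\<close>

lemma max_free_Un_reserve_aux:
  assumes d: "block_job d" and pos: "\<And>j. j \<in> set J \<Longrightarrow> 1 \<le> release j"
    and feas: "\<exists>\<sigma>. feasible_job_schedule J \<sigma>" and W: "finite W"
  shows "max_free J (job_interval d \<union> W) + (\<Sum>j<length J. proc (J ! j)) =
    card (job_interval d) + (\<Sum>j<length J. proc (reserve d J ! j)) + max_free (reserve d J) W"
    (is "_ + ?P = _ + ?P' + _")
\<comment> \<open>Both totals are added so that no difference is truncated. \<open>?P - ?P'\<close>
  is the number of units that the jobs are forced to place inside the reserved interval.\<close>
proof (rule antisym)
  let ?V = "job_interval d"
  have finV: "finite ?V" by (simp add: job_interval_def)
  have split: "card (?V \<union> W - X) + card X = card ?V + card (X - ?V) + card (W - ?V - X)"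
    if "finite X" for X
  proof -
    have "card (?V \<union> W - X) = card (?V - X) + card (W - ?V - X)"
      using finV W by (subst card_Un_disjoint[symmetric]) (auto intro: arg_cong[of _ _ card])
    moreover have "card ?V = card (?V - X) + card (X \<inter> ?V)"
      using finV by (subst card_Un_disjoint[symmetric]) (auto intro: arg_cong[of _ _ card])
    moreover have "card X = card (X - ?V) + card (X \<inter> ?V)"
      using that by (subst card_Un_disjoint[symmetric]) (auto intro: arg_cong[of _ _ card])
    ultimately show ?thesis by simp
  qed
  have feas': "\<exists>\<sigma>. feasible_job_schedule (reserve d J) \<sigma>"
    using Hall_feasible[OF Hall_reserve[OF d pos]] .
  show "max_free J (?V \<union> W) + ?P \<le> card ?V + ?P' + max_free (reserve d J) W"
  proof -
    obtain \<sigma> where \<sigma>: "feasible_job_schedule J \<sigma>" "max_free J (?V \<union> W) = card (?V \<union> W - used J \<sigma>)"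
      using max_free_obtain[of "?V \<union> W" J] feas finV W by auto
    obtain \<tau> where \<tau>: "feasible_job_schedule (reserve d J) \<tau>" "used J \<sigma> - ?V \<subseteq> used J \<tau>"
      using reserve_covers_free[OF d pos \<sigma>(1)] by blast
    note u = used_reserve[OF d \<tau>(1)]
    \<comment> \<open>Apart from the interval itself, \<open>\<tau>\<close> uses the slots of
      \<open>\<sigma>\<close> outside it and the set \<open>?Y\<close>. These are \<open>?P'\<close>
      slots in total, which determines the size of \<open>?Y\<close>.\<close>
    let ?Y = "used J \<tau> - (used J \<sigma> - ?V)"
    have "card (W - ?V - used J \<sigma>) \<le> card ((W - used (reserve d J) \<tau>) \<union> ?Y)"
      using W u by (intro card_mono) auto
    also have "\<dots> \<le> card (W - used (reserve d J) \<tau>) + card ?Y" by (rule card_Un_le)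
    also have "card ?Y = ?P' - card (used J \<sigma> - ?V)"
      using \<tau>(2) u(3,4) by (subst card_Diff_subset) (auto intro: finite_subset)
    finally have "card (W - ?V - used J \<sigma>) + card (used J \<sigma> - ?V) \<le> card (W - used (reserve d J) \<tau>) + ?P'"
      using card_mono[OF u(3) \<tau>(2)] u(4) by linarith
    with split[OF card_used(1)[OF \<sigma>(1)]] card_used(2)[OF \<sigma>(1)] max_free_ge[OF W \<tau>(1)] \<sigma>(2)
    show ?thesis by linarith
  qed
  show "card ?V + ?P' + max_free (reserve d J) W \<le> max_free J (?V \<union> W) + ?P"
  proof -
    obtain \<tau> where \<tau>: "feasible_job_schedule (reserve d J) \<tau>"
        "max_free (reserve d J) W = card (W - used (reserve d J) \<tau>)"
      using max_free_obtain[of W "reserve d J"] feas' W by auto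
    note u = used_reserve[OF d \<tau>(1)]
    have "partial_schedule {..<length J} (\<lambda>i. job_interval (J ! i)) (\<lambda>i. proc (J ! i)) \<tau>"
      unfolding partial_schedule_def
    proof (intro conjI ballI impI)
      fix i assume i: "i \<in> {..<length J}"
      then have "\<tau> i \<subseteq> job_interval (reserve d J ! i)" "card (\<tau> i) = proc (reserve d J ! i)"
        using \<tau>(1) unfolding feasible_job_schedule_def by auto
      then show "\<tau> i \<subseteq> job_interval (J ! i)" "card (\<tau> i) \<le> proc (J ! i)"
        using i by (simp_all add: reserve_nth max_proc_le)
      fix k assume "k \<in> {..<length J}" "i \<noteq> k"
      then show "\<tau> i \<inter> \<tau> k = {}" using \<tau>(1) i unfolding feasible_job_schedule_def by simp
    qed
    then obtain \<sigma> where \<sigma>: "feasible_job_schedule J \<sigma>" "used J \<tau> \<subseteq> used J \<sigma>"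
      using partial_schedule_extend feas unfolding used_def by blast
    \<comment> \<open>A covering schedule shows that \<open>\<sigma>\<close> uses at most
      \<open>?P'\<close> slots outside the interval, as many as \<open>\<tau>\<close> already does;
      so extending \<open>\<tau>\<close> to \<open>\<sigma>\<close> has added only slots of the
      interval.\<close>
    obtain \<tau>' where \<tau>': "feasible_job_schedule (reserve d J) \<tau>'" "used J \<sigma> - ?V \<subseteq> used J \<tau>'"
      using reserve_covers_free[OF d pos \<sigma>(1)] by blast
    have sub: "used J \<tau> \<subseteq> used J \<sigma> - ?V" using \<sigma>(2) u(2) by blast
    have "used J \<tau> = used J \<tau>'"
      using sub \<tau>'(2) used_reserve[OF d \<tau>'(1)] u(4) by (intro card_subset_eq) auto
    then have eq: "used J \<sigma> - ?V = used J \<tau>" using sub \<tau>'(2) by blast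
    have "W - used (reserve d J) \<tau> = W - ?V - used J \<sigma>" using eq u(1) by blast
    with split[OF card_used(1)[OF \<sigma>(1)]] card_used(2)[OF \<sigma>(1)] max_free_ge[OF _ \<sigma>(1), of "?V \<union> W"]
      \<tau>(2) eq u(4) finV W
    show ?thesis by simp
  qed
qed

text \<open>Comparison with the case \<open>W = {}\<close> eliminates the totals of the processing
  times.\<close>

lemma max_free_Un_reserve:
  assumes "block_job d" "\<And>j. j \<in> set J \<Longrightarrow> 1 \<le> release j"
    and feas: "\<exists>\<sigma>. feasible_job_schedule J \<sigma>" and "finite W"
  shows "max_free J (job_interval d \<union> W) = max_free J (job_interval d) + max_free (reserve d J) W"
proof -
  have feas': "\<exists>\<sigma>. feasible_job_schedule (reserve d J) \<sigma>"
    using Hall_feasible[OF Hall_reserve[OF assms(1,2)]] .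
  have "max_free (reserve d J) {} = 0"
    using max_free_obtain[of "{}" "reserve d J"] feas' by auto
  with max_free_Un_reserve_aux[OF assms] max_free_Un_reserve_aux[OF assms(1,2) feas, of "{}"]
  show ?thesis by simp
qed

section \<open>The greedy algorithm\<close>

definition total_free :: "job list list \<Rightarrow> nat set \<Rightarrow> nat" where
  "total_free Js U = sum_list (map (\<lambda>J. max_free J U) Js)"

definition event_slots :: "nat \<Rightarrow> nat \<Rightarrow> nat \<Rightarrow> nat set" where
  "event_slots T l t = {1..T} \<inter> {t..<t + l}"

text \<open>The deadline is \<open>min (t + l - 1) T\<close>, written with truncated subtraction only.\<close>

definition event_job :: "nat \<Rightarrow> nat \<Rightarrow> nat \<Rightarrow> job" where
  "event_job T l t = \<lparr>release = t, deadline = T - (T - (t - 1) - l),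
     proc = T - (T - (t - 1) - l) - (t - 1)\<rparr>"

lemma event_job:
  assumes "t \<in> {1..T}" "1 \<le> l"
  shows "job_interval (event_job T l t) = event_slots T l t" "block_job (event_job T l t)"
    "num_slots I = T \<Longrightarrow> valid_job I (event_job T l t)"
proof -
  show "job_interval (event_job T l t) = event_slots T l t"
    using assms by (auto simp: job_interval_def event_job_def event_slots_def)
  show "block_job (event_job T l t)" "num_slots I = T \<Longrightarrow> valid_job I (event_job T l t)"
    using assms by (auto simp: block_job_def job_interval_def event_job_def valid_job_def time_slots_def)
qed

lemma finite_event_slots [simp]: "finite (event_slots T l t)"
  by (simp add: event_slots_def)

lemma valid_psba_single:
  "valid_psba \<lparr>num_slots = T, event_len = l # ls, job_sets = Js\<rparr> \<Longrightarrow>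
     valid_psba \<lparr>num_slots = T, event_len = [l], job_sets = Js\<rparr>"
  by (auto simp: valid_psba_def valid_job_def time_slots_def)

text \<open>Serves twice: for the validity of the contracted instance and for bounding the sizes of
  its jobs.\<close>

lemma reserve_mem:
  "k \<in> set (reserve d J) \<Longrightarrow> k = d \<or>
    (\<exists>j\<in>set J. release k = release j \<and> deadline k = deadline j \<and> proc k \<le> proc j)"
  by (induction J) (auto simp: max_proc_le)

lemma valid_psba_release_pos:
  "valid_psba I \<Longrightarrow> J \<in> set (job_sets I) \<Longrightarrow> j \<in> set J \<Longrightarrow> 1 \<le> release j"
  by (auto simp: valid_psba_def valid_job_def time_slots_def)

lemma valid_psba_reserve:
  assumes I: "valid_psba \<lparr>num_slots = T, event_len = l # ls, job_sets = Js\<rparr>" and t: "t \<in> {1..T}"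
  shows "valid_psba \<lparr>num_slots = T, event_len = ls, job_sets = map (reserve (event_job T l t)) Js\<rparr>"
    (is "valid_psba ?I'")
proof -
  have l: "1 \<le> l" using I by (simp add: valid_psba_def)
  have "(\<forall>j\<in>set (reserve (event_job T l t) J). valid_job ?I' j) \<and>
      (\<exists>\<sigma>. feasible_job_schedule (reserve (event_job T l t) J) \<sigma>)" if J: "J \<in> set Js" for J
  proof
    have pos: "1 \<le> release j" if "j \<in> set J" for j
      using valid_psba_release_pos[OF I] J that by simp
    show "\<exists>\<sigma>. feasible_job_schedule (reserve (event_job T l t) J) \<sigma>"
      by (intro Hall_feasible Hall_reserve event_job(2) t l pos)
    have old: "valid_job ?I' j" if "j \<in> set J" for j
      using I J that by (auto simp: valid_psba_def valid_job_def time_slots_def)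
    show "\<forall>j\<in>set (reserve (event_job T l t) J). valid_job ?I' j"
    proof
      fix k assume "k \<in> set (reserve (event_job T l t) J)"
      then show "valid_job ?I' k"
        using reserve_mem[of k] event_job(3)[OF t l, of ?I'] old by (fastforce simp: valid_job_def)
    qed
  qed
  with I show ?thesis by (simp add: valid_psba_def)
qed

lemma total_free_mono:
  assumes "valid_psba I" "finite V" "U \<subseteq> V"
  shows "total_free (job_sets I) U \<le> total_free (job_sets I) V"
  unfolding total_free_def using assms
  by (intro sum_list_mono max_free_mono) (auto simp: valid_psba_def)

lemma total_free_Un:
  assumes "valid_psba I" "finite U" "finite V"
  shows "total_free (job_sets I) (U \<union> V) \<le> total_free (job_sets I) U + total_free (job_sets I) V"
  unfolding total_free_def sum_list_addf[symmetric] using assms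
  by (intro sum_list_mono max_free_Un) (auto simp: valid_psba_def)

lemma total_free_reserve:
  assumes "valid_psba \<lparr>num_slots = T, event_len = l # ls, job_sets = Js\<rparr>" "t \<in> {1..T}" "finite W"
  shows "total_free Js (event_slots T l t \<union> W) =
    total_free Js (event_slots T l t) + total_free (map (reserve (event_job T l t)) Js) W"
proof -
  have l: "1 \<le> l" using assms(1) by (simp add: valid_psba_def)
  note ev = event_job(1)[OF assms(2) l]
  have "max_free J (event_slots T l t \<union> W) =
      max_free J (event_slots T l t) + max_free (reserve (event_job T l t) J) W" if "J \<in> set Js" for J
    using max_free_Un_reserve[OF event_job(2)[OF assms(2) l] _ _ assms(3), of J]
      valid_psba_release_pos[OF assms(1)] assms(1) that unfolding ev by (auto simp: valid_psba_def)
  then have "(\<Sum>J\<leftarrow>Js. max_free J (event_slots T l t \<union> W)) =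
      (\<Sum>J\<leftarrow>Js. max_free J (event_slots T l t) + max_free (reserve (event_job T l t) J) W)"
    by (intro arg_cong[where f = sum_list] map_cong refl)
  then show ?thesis by (simp only: total_free_def sum_list_addf map_map o_def)
qed

fun covered :: "nat \<Rightarrow> nat list \<Rightarrow> nat list \<Rightarrow> nat set" where
  "covered T (l # ls) (t # ts) = event_slots T l t \<union> covered T ls ts"
| "covered T _ _ = {}"

lemma finite_covered [simp]: "finite (covered T ls ts)"
  by (induction T ls ts rule: covered.induct) auto

text \<open>\<open>h\<close> stands for the given algorithm, reduced to the start slot that it
  picks. The events are taken in input order, as the analysis compares each event with the same
  event of the competitor.\<close>

fun greedy_starts :: "(psba \<Rightarrow> nat) \<Rightarrow> nat \<Rightarrow> job list list \<Rightarrow> nat list \<Rightarrow> nat list" where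
  "greedy_starts h T Js [] = []"
| "greedy_starts h T Js (l # ls) =
     (let t = h \<lparr>num_slots = T, event_len = [l], job_sets = Js\<rparr>
      in t # greedy_starts h T (map (reserve (event_job T l t)) Js) ls)"

definition single_event_approx :: "real \<Rightarrow> (psba \<Rightarrow> nat) \<Rightarrow> bool" where
  "single_event_approx \<alpha> h \<longleftrightarrow>
     (\<forall>T l Js. valid_psba \<lparr>num_slots = T, event_len = [l], job_sets = Js\<rparr> \<longrightarrow>
        (let t = h \<lparr>num_slots = T, event_len = [l], job_sets = Js\<rparr>
         in t \<in> {1..T} \<and> (\<forall>t'\<in>{1..T}. real (total_free Js (event_slots T l t'))
              \<le> \<alpha> * real (total_free Js (event_slots T l t)))))"

lemma length_greedy_starts [simp]: "length (greedy_starts h T Js ls) = length ls"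
  by (induction ls arbitrary: Js) (auto simp: Let_def)

lemma greedy_starts_range:
  assumes "single_event_approx \<alpha> h"
  shows "valid_psba \<lparr>num_slots = T, event_len = ls, job_sets = Js\<rparr> \<Longrightarrow> set (greedy_starts h T Js ls) \<subseteq> {1..T}"
proof (induction ls arbitrary: Js)
  case (Cons l ls)
  let ?t = "h \<lparr>num_slots = T, event_len = [l], job_sets = Js\<rparr>"
  have t: "?t \<in> {1..T}"
    using assms valid_psba_single[OF Cons.prems] by (simp add: single_event_approx_def Let_def)
  from Cons.IH[OF valid_psba_reserve[OF Cons.prems t]] t show ?case by (simp add: Let_def)
qed simp

text \<open>With \<open>V\<close> the slots of the first greedy event and \<open>V'\<close>, \<open>W\<close> those of the first and of the
  remaining events of a competitor, \<open>f (V' \<union> W) \<le> f V' + f (V \<union> W) = f V' + f V + f' W\<close>, where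
  \<open>f'\<close> is the objective after reserving \<open>V\<close>, and \<open>f V' \<le> \<alpha> * f V\<close>.\<close>

lemma greedy_starts_approx:
  assumes h: "single_event_approx \<alpha> h" and \<alpha>: "\<alpha> \<ge> 1"
  shows "valid_psba \<lparr>num_slots = T, event_len = ls, job_sets = Js\<rparr> \<Longrightarrow> length ts = length ls \<Longrightarrow>
    set ts \<subseteq> {1..T} \<Longrightarrow>
    real (total_free Js (covered T ls ts)) \<le> (\<alpha> + 1) * real (total_free Js (covered T ls (greedy_starts h T Js ls)))"
proof (induction ls arbitrary: Js ts)
  case Nil
  then have "0 \<le> \<alpha> * real (total_free Js {})" using \<alpha> by simp
  then show ?case by (simp add: algebra_simps)
next
  case (Cons l ls)
  obtain t' ts' where ts: "ts = t' # ts'" using Cons.prems(2) by (cases ts) auto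
  define I where "I = \<lparr>num_slots = T, event_len = l # ls, job_sets = Js\<rparr>"
  have I: "valid_psba I" and Js: "job_sets I = Js" using Cons.prems(1) by (simp_all add: I_def)
  define t where "t = h \<lparr>num_slots = T, event_len = [l], job_sets = Js\<rparr>"
  have t: "t \<in> {1..T}" and approx:
    "real (total_free Js (event_slots T l t')) \<le> \<alpha> * real (total_free Js (event_slots T l t))"
    using h valid_psba_single[OF Cons.prems(1)] Cons.prems(3)
    by (simp_all add: single_event_approx_def Let_def t_def ts)
  define Js' where "Js' = map (reserve (event_job T l t)) Js"
  define f f' where "f U = real (total_free Js U)" and "f' U = real (total_free Js' U)" for U
  let ?V = "event_slots T l t" and ?V' = "event_slots T l t'"
  let ?W = "covered T ls ts'" and ?G = "covered T ls (greedy_starts h T Js' ls)"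
  have IH: "f' ?W \<le> (\<alpha> + 1) * f' ?G"
    using Cons.IH[OF valid_psba_reserve[OF Cons.prems(1) t], of ts'] Cons.prems(2,3)
    by (simp add: ts f'_def Js'_def)
  have split: "f (?V \<union> U) = f ?V + f' U" if "finite U" for U
    using total_free_reserve[OF Cons.prems(1) t that] by (simp add: f_def f'_def Js'_def)
  have "f (?V' \<union> ?W) \<le> f ?V' + f ?W"
    using total_free_Un[OF I, of ?V' ?W] by (simp add: f_def Js flip: of_nat_add)
  also have "f ?W \<le> f (?V \<union> ?W)"
    using total_free_mono[OF I, of "?V \<union> ?W" ?W] by (simp add: f_def Js)
  also have "f (?V \<union> ?W) = f ?V + f' ?W" by (rule split) simp
  also have "f ?V' + (f ?V + f' ?W) \<le> \<alpha> * f ?V + (f ?V + (\<alpha> + 1) * f' ?G)"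
    using IH approx by (simp add: f_def)
  also have "\<dots> = (\<alpha> + 1) * f (?V \<union> ?G)" by (simp add: split algebra_simps)
  finally show ?case by (simp add: ts f_def t_def Js'_def Let_def)
qed

section \<open>Complete schedules as lists of start slots\<close>

lemma agr_eq_max_free: "agr I i S = max_free (job_sets I ! i) (occupied_slots I S)"
  by (simp add: agr_def max_free_def agreement_slots_def used_def)

lemma schedule_value_eq: "schedule_value I S = total_free (job_sets I) (occupied_slots I S)"
  by (simp add: schedule_value_def agr_eq_max_free total_free_def sum_list_sum_nth atLeast0LessThan)

lemma covered_eq: "length ts = length ls \<Longrightarrow> covered T ls ts = (\<Union>e<length ls. event_slots T (ls ! e) (ts ! e))"
proof (induction ls arbitrary: ts)
  case (Cons l ls)
  then obtain t ts' where "ts = t # ts'" by (cases ts) auto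
  with Cons show ?case by (simp add: lessThan_Suc_eq_insert_0)
qed simp

lemma set_zip_upt: "set (zip [0..<length ts] ts) = {(e, ts ! e) | e. e < length ts}"
  unfolding set_zip by (intro Collect_cong ex_cong1) auto

lemma complete_schedule_zip:
  assumes "length ts = length (event_len I)" "set ts \<subseteq> {1..num_slots I}"
  shows "complete_schedule I (set (zip [0..<length ts] ts))"
    "occupied_slots I (set (zip [0..<length ts] ts)) = covered (num_slots I) (event_len I) ts"
proof -
  note zip = set_zip_upt[of ts]
  show "complete_schedule I (set (zip [0..<length ts] ts))"
    using assms unfolding complete_schedule_def event_schedule_def time_slots_def zip
    by (fastforce dest: nth_mem)
  show "occupied_slots I (set (zip [0..<length ts] ts)) = covered (num_slots I) (event_len I) ts"
    unfolding covered_eq[OF assms(1)] zip using assms(1)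
    by (auto simp: occupied_slots_def event_slots_def time_slots_def)
qed

lemma complete_schedule_obtain:
  assumes "complete_schedule I S"
  obtains ts where "length ts = length (event_len I)" "set ts \<subseteq> {1..num_slots I}"
    "S = set (zip [0..<length ts] ts)"
proof -
  let ?n = "length (event_len I)"
  have sub: "S \<subseteq> {..<?n} \<times> {1..num_slots I}" and ex: "\<And>e. e < ?n \<Longrightarrow> \<exists>!t. (e, t) \<in> S"
    using assms by (auto simp: complete_schedule_def event_schedule_def time_slots_def)
  define ts where "ts = map (\<lambda>e. THE t. (e, t) \<in> S) [0..<?n]"
  have the: "(e, t) \<in> S \<longleftrightarrow> t = ts ! e" if "e < ?n" for e t
    using theI'[OF ex[OF that]] ex[OF that] that by (auto simp: ts_def)
  show ?thesis
  proof (rule that)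
    show len: "length ts = ?n" by (simp add: ts_def)
    show "S = set (zip [0..<length ts] ts)"
      using sub the len unfolding set_zip_upt by auto
    show "set ts \<subseteq> {1..num_slots I}"
      using sub the len by (fastforce simp: in_set_conv_nth)
  qed
qed

lemma finite_complete_schedules: "finite {S. complete_schedule I S}"
  by (rule finite_subset[of _ "Pow ({..<length (event_len I)} \<times> {1..num_slots I})"])
     (auto simp: complete_schedule_def event_schedule_def time_slots_def)

lemma opt_value_ge: "complete_schedule I S \<Longrightarrow> schedule_value I S \<le> opt_value I"
  unfolding opt_value_def using finite_complete_schedules by (intro Max_ge) auto

lemma opt_value_obtain:
  assumes "num_slots I \<ge> 1"
  obtains S where "complete_schedule I S" "opt_value I = schedule_value I S"
proof -
  \<comment> \<open>Starting everything in slot 1 gives some complete schedule, so the maximum in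
    \<open>opt_value\<close> is taken over a nonempty set.\<close>
  let ?ts = "replicate (length (event_len I)) (1::nat)"
  have "complete_schedule I (set (zip [0..<length ?ts] ?ts))"
    using assms by (intro complete_schedule_zip) auto
  then have "opt_value I \<in> {schedule_value I S | S. complete_schedule I S}"
    unfolding opt_value_def using finite_complete_schedules by (intro Max_in) auto
  with that show ?thesis by auto
qed

lemma greedy_schedule:
  assumes h: "single_event_approx \<alpha> h" and \<alpha>: "\<alpha> \<ge> 1" and I: "valid_psba I"
    and S: "S = set (zip [0..<length (event_len I)] (greedy_starts h (num_slots I) (job_sets I) (event_len I)))"
  shows "complete_schedule I S" "real (schedule_value I S) \<ge> 1 / (\<alpha> + 1) * real (opt_value I)"
proof -
  let ?ts = "greedy_starts h (num_slots I) (job_sets I) (event_len I)"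
  have I': "valid_psba \<lparr>num_slots = num_slots I, event_len = event_len I, job_sets = job_sets I\<rparr>"
    using I by (cases I) simp
  have S': "S = set (zip [0..<length ?ts] ?ts)" using S by simp
  note z = complete_schedule_zip[of ?ts I, OF length_greedy_starts greedy_starts_range[OF h I'], folded S']
  show "complete_schedule I S" by (rule z(1))
  obtain Opt where Opt: "complete_schedule I Opt" "opt_value I = schedule_value I Opt"
    using opt_value_obtain I unfolding valid_psba_def by blast
  obtain ts where ts: "length ts = length (event_len I)" "set ts \<subseteq> {1..num_slots I}"
      "Opt = set (zip [0..<length ts] ts)"
    using complete_schedule_obtain[OF Opt(1)] by blast
  have "real (opt_value I) \<le> (\<alpha> + 1) * real (schedule_value I S)"
    using greedy_starts_approx[OF h \<alpha> I' ts(1,2)] complete_schedule_zip(2)[OF ts(1,2)] z(2)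
    by (simp add: Opt(2) schedule_value_eq ts(3))
  then show "real (schedule_value I S) \<ge> 1 / (\<alpha> + 1) * real (opt_value I)"
    using \<alpha> by (simp add: field_simps)
qed

text \<open>The head suffices: the list may mention the single pair of a complete schedule repeatedly.\<close>

lemma single_event_approxI:
  assumes "\<alpha> \<ge> 1"
    and "\<And>I. valid_psba I \<Longrightarrow> length (event_len I) = 1 \<Longrightarrow> complete_schedule I (set (f I)) \<and>
      real (schedule_value I (set (f I))) \<ge> 1 / \<alpha> * real (opt_value I)"
  shows "single_event_approx \<alpha> (\<lambda>I. snd (hd (f I)))"
    "\<And>I. valid_psba I \<Longrightarrow> length (event_len I) = 1 \<Longrightarrow> f I \<noteq> []"
proof -
  have single: "\<exists>t\<in>{1..num_slots I}. set (f I) = {(0, t)}"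
    if I: "valid_psba I" "length (event_len I) = 1" for I
  proof -
    obtain ts where ts: "length ts = length (event_len I)" "set ts \<subseteq> {1..num_slots I}"
        "set (f I) = set (zip [0..<length ts] ts)"
      using complete_schedule_obtain assms(2)[OF I] by blast
    from ts(1) I(2) obtain t where t: "ts = [t]" by (auto simp: length_Suc_conv)
    from ts(2,3) show ?thesis unfolding t by simp
  qed
  show "f I \<noteq> []" if "valid_psba I" "length (event_len I) = 1" for I
    using single[OF that] by auto
  show "single_event_approx \<alpha> (\<lambda>I. snd (hd (f I)))"
    unfolding single_event_approx_def Let_def
  proof (intro allI impI)
    fix T l Js
    define I where "I = \<lparr>num_slots = T, event_len = [l], job_sets = Js\<rparr>"
    assume "valid_psba \<lparr>num_slots = T, event_len = [l], job_sets = Js\<rparr>"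
    then have I: "valid_psba I" "length (event_len I) = 1" by (simp_all add: I_def)
    obtain t where t: "t \<in> {1..T}" "set (f I) = {(0, t)}"
      using single[OF I] by (auto simp: I_def)
    have hd: "snd (hd (f I)) = t" using t(2) hd_in_set[of "f I"] by (cases "f I = []") auto
    have val: "schedule_value I {(0, s)} = total_free Js (event_slots T l s)" for s
      by (simp add: schedule_value_eq occupied_slots_def event_slots_def time_slots_def I_def)
    have "real (total_free Js (event_slots T l s)) \<le> \<alpha> * real (total_free Js (event_slots T l t))"
      if s: "s \<in> {1..T}" for s
    proof -
      have "complete_schedule I {(0, s)}"
        using complete_schedule_zip(1)[of "[s]" I] s by (simp add: I_def)
      then have "real (total_free Js (event_slots T l s)) \<le> real (opt_value I)"
        using opt_value_ge by (simp flip: val)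
      moreover have "1 / \<alpha> * real (opt_value I) \<le> real (total_free Js (event_slots T l t))"
        using assms(2)[OF I] t(2) by (simp add: val)
      ultimately show ?thesis using assms(1) by (simp add: field_simps)
    qed
    then show "snd (hd (f \<lparr>num_slots = T, event_len = [l], job_sets = Js\<rparr>)) \<in> {1..T} \<and>
      (\<forall>t'\<in>{1..T}. real (total_free Js (event_slots T l t')) \<le> \<alpha> * real (total_free Js
        (event_slots T l (snd (hd (f \<lparr>num_slots = T, event_len = [l], job_sets = Js\<rparr>))))))"
      using hd t(1) unfolding I_def by simp
  qed
qed

section \<open>Programs as subroutines\<close>

fun expr_vars :: "expr \<Rightarrow> nat set" where
  "expr_vars (EVar x) = {x}"
| "expr_vars ELeaf = {}"
| "expr_vars (ENode a b) = expr_vars a \<union> expr_vars b"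
| "expr_vars (EHd a) = expr_vars a"
| "expr_vars (ETl a) = expr_vars a"
| "expr_vars (EEq a b) = expr_vars a \<union> expr_vars b"

fun com_vars :: "com \<Rightarrow> nat set" where
  "com_vars (Assign x e) = insert x (expr_vars e)"
| "com_vars (Seq c1 c2) = com_vars c1 \<union> com_vars c2"
| "com_vars (Cond e c1 c2) = expr_vars e \<union> com_vars c1 \<union> com_vars c2"
| "com_vars (While e c) = expr_vars e \<union> com_vars c"

lemma finite_expr_vars: "finite (expr_vars e)"
  by (induction e) auto

lemma finite_com_vars: "finite (com_vars c)"
  by (induction c) (auto simp: finite_expr_vars)

lemma eval_cong: "(\<And>x. x \<in> expr_vars e \<Longrightarrow> s x = r x) \<Longrightarrow> eval e s = eval e r"
  by (induction e) auto

lemma eval_cost_cong: "(\<And>x. x \<in> expr_vars e \<Longrightarrow> s x = r x) \<Longrightarrow> eval_cost e s = eval_cost e r"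
proof (induction e)
  case (ENode a b)
  then show ?case using eval_cong[of "ENode a b" s r] by simp
next
  case (EHd a)
  then show ?case using eval_cong[of "EHd a" s r] by simp
next
  case (ETl a)
  then show ?case using eval_cong[of "ETl a" s r] by simp
next
  case (EEq a b)
  then show ?case using eval_cong[of "EEq a b" s r] by simp
qed auto

text \<open>A run depends only on the variables of the program and leaves all others alone, at equal
  cost. So a program made for an empty memory can run amid the variables of a caller.\<close>

lemma exec_frame:
  assumes "exec c s n s'" "com_vars c \<subseteq> X" "\<And>x. x \<in> X \<Longrightarrow> s x = r x"
  shows "\<exists>r'. exec c r n r' \<and> (\<forall>x\<in>X. s' x = r' x) \<and> (\<forall>x. x \<notin> X \<longrightarrow> r' x = r x)"
  using assms
proof (induction arbitrary: r rule: exec.induct)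
  case (Assign x e s)
  have "eval e s = eval e r" "eval_cost e s = eval_cost e r"
    using Assign by (auto intro!: eval_cong eval_cost_cong)
  then have "exec (Assign x e) r (1 + eval_cost e s) (r(x := eval e s))"
    using exec.Assign[of x e r] by simp
  moreover have "\<forall>y\<in>X. (s(x := eval e s)) y = (r(x := eval e s)) y"
      "\<forall>y. y \<notin> X \<longrightarrow> (r(x := eval e s)) y = r y"
    using Assign by auto
  ultimately show ?case by blast
next
  case (Seq c1 s n1 s1 c2 n2 s2)
  obtain r1 where r1: "exec c1 r n1 r1" "\<forall>x\<in>X. s1 x = r1 x" "\<forall>x. x \<notin> X \<longrightarrow> r1 x = r x"
    using Seq.IH(1)[of r] Seq.prems by auto
  obtain r2 where "exec c2 r1 n2 r2" "\<forall>x\<in>X. s2 x = r2 x" "\<forall>x. x \<notin> X \<longrightarrow> r2 x = r1 x"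
    using Seq.IH(2)[of r1] Seq.prems r1(2) by auto
  with r1 exec.Seq show ?case by metis
next
  case (CondTrue e s c1 n s1 c2)
  have "eval e s = eval e r" "eval_cost e s = eval_cost e r"
    using CondTrue.prems by (auto intro!: eval_cong eval_cost_cong)
  moreover obtain r' where "exec c1 r n r'" "\<forall>x\<in>X. s1 x = r' x" "\<forall>x. x \<notin> X \<longrightarrow> r' x = r x"
    using CondTrue.IH[of r] CondTrue.prems by auto
  ultimately show ?case using CondTrue.hyps exec.CondTrue[of e r c1 n r' c2] by metis
next
  case (CondFalse e s c2 n s1 c1)
  have "eval e s = eval e r" "eval_cost e s = eval_cost e r"
    using CondFalse.prems by (auto intro!: eval_cong eval_cost_cong)
  moreover obtain r' where "exec c2 r n r'" "\<forall>x\<in>X. s1 x = r' x" "\<forall>x. x \<notin> X \<longrightarrow> r' x = r x"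
    using CondFalse.IH[of r] CondFalse.prems by auto
  ultimately show ?case using CondFalse.hyps exec.CondFalse[of e r c2 n r' c1] by metis
next
  case (WhileFalse e s c)
  have "eval e s = eval e r" "eval_cost e s = eval_cost e r"
    using WhileFalse.prems by (auto intro!: eval_cong eval_cost_cong)
  then show ?case using WhileFalse exec.WhileFalse[of e r c] by metis
next
  case (WhileTrue e s c n1 s1 n2 s2)
  have e: "eval e s = eval e r" "eval_cost e s = eval_cost e r"
    using WhileTrue.prems by (auto intro!: eval_cong eval_cost_cong)
  obtain r1 where r1: "exec c r n1 r1" "\<forall>x\<in>X. s1 x = r1 x" "\<forall>x. x \<notin> X \<longrightarrow> r1 x = r x"
    using WhileTrue.IH(1)[of r] WhileTrue.prems by auto
  obtain r2 where "exec (While e c) r1 n2 r2" "\<forall>x\<in>X. s2 x = r2 x" "\<forall>x. x \<notin> X \<longrightarrow> r2 x = r1 x"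
    using WhileTrue.IH(2)[of r1] WhileTrue.prems r1(2) by auto
  with r1 e exec.WhileTrue[of e r c n1 r1 n2 r2] WhileTrue.hyps show ?case by metis
qed

lemma size_eval_le: "size (eval e s) \<le> eval_cost e s"
  by (cases e) auto

text \<open>Every tree that is built is paid for in time, so time bounds also yield size bounds for
  outputs.\<close>

lemma exec_size:
  assumes "exec c s n s'" "\<And>x. size (s x) \<le> M"
  shows "size (s' x) \<le> M + n"
  using assms
proof (induction arbitrary: x M rule: exec.induct)
  case (Assign y e s)
  then have "size (s x) \<le> M" by blast
  then show ?case using size_eval_le[of e s] by (cases "x = y") simp_all
next
  case (Seq c1 s n1 s1 c2 n2 s2)
  then show ?case using Seq.IH(2)[of "M + n1"] by (simp add: add.assoc)
next
  case (WhileTrue e s c n1 s1 n2 s2)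
  then have "size (s2 x) \<le> (M + n1) + n2" by blast
  then show ?case by linarith
next
  case (CondTrue e s c1 n s1 c2)
  then have "size (s1 x) \<le> M + n" by blast
  then show ?case by simp
next
  case (CondFalse e s c2 n s1 c1)
  then have "size (s1 x) \<le> M + n" by blast
  then show ?case by simp
next
  case (WhileFalse e s c)
  then have "size (s x) \<le> M" by blast
  then show ?case by simp
qed

text \<open>\<open>steps N c s b s'\<close> ignores the contents of the variables \<open>0, \<dots>, N\<close>, which are the
  workspace of subroutines.\<close>

definition steps :: "nat \<Rightarrow> com \<Rightarrow> state \<Rightarrow> nat \<Rightarrow> state \<Rightarrow> bool" where
  "steps N c s b s' \<longleftrightarrow> (\<forall>r. (\<forall>i>N. r i = s i) \<longrightarrow>
     (\<exists>r' n. exec c r n r' \<and> n \<le> b \<and> (\<forall>i>N. r' i = s' i)))"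

lemma steps_mono: "steps N c s b s' \<Longrightarrow> b \<le> b' \<Longrightarrow> steps N c s b' s'"
  unfolding steps_def by (meson order_trans)

lemma steps_Assign:
  assumes "expr_vars e \<subseteq> {N<..}"
  shows "steps N (Assign k e) s (1 + eval_cost e s) (s(k := eval e s))"
  unfolding steps_def
proof (intro allI impI)
  fix r assume r: "\<forall>i>N. r i = s i"
  have "eval e r = eval e s" "eval_cost e r = eval_cost e s"
    using assms r by (auto intro!: eval_cong eval_cost_cong)
  with r show "\<exists>r' n. exec (Assign k e) r n r' \<and> n \<le> 1 + eval_cost e s \<and> (\<forall>i>N. r' i = (s(k := eval e s)) i)"
    using exec.Assign[of k e r] by fastforce
qed

lemma steps_Seq:
  assumes "steps N c1 s b1 s1" "steps N c2 s1 b2 s2"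
  shows "steps N (Seq c1 c2) s (b1 + b2) s2"
  unfolding steps_def
proof (intro allI impI)
  fix r assume r: "\<forall>i>N. r i = s i"
  obtain r1 n1 where 1: "exec c1 r n1 r1" "n1 \<le> b1" "\<forall>i>N. r1 i = s1 i"
    using assms(1) r unfolding steps_def by blast
  then obtain r2 n2 where "exec c2 r1 n2 r2" "n2 \<le> b2" "\<forall>i>N. r2 i = s2 i"
    using assms(2) unfolding steps_def by blast
  with 1 show "\<exists>r' n. exec (Seq c1 c2) r n r' \<and> n \<le> b1 + b2 \<and> (\<forall>i>N. r' i = s2 i)"
    using exec.Seq add_mono by blast
qed

lemma steps_Cond:
  assumes e: "expr_vars e \<subseteq> {N<..}" and c: "steps N (if eval e s \<noteq> Leaf then c1 else c2) s b s'"
  shows "steps N (Cond e c1 c2) s (1 + eval_cost e s + b) s'"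
  unfolding steps_def
proof (intro allI impI)
  fix r assume r: "\<forall>i>N. r i = s i"
  have eq: "eval e r = eval e s" "eval_cost e r = eval_cost e s"
    using e r by (auto intro!: eval_cong eval_cost_cong)
  obtain r' n where "exec (if eval e s \<noteq> Leaf then c1 else c2) r n r'" "n \<le> b" "\<forall>i>N. r' i = s' i"
    using c r unfolding steps_def by blast
  then show "\<exists>r' n. exec (Cond e c1 c2) r n r' \<and> n \<le> 1 + eval_cost e s + b \<and> (\<forall>i>N. r' i = s' i)"
    using exec.CondTrue[of e r c1 n r' c2] exec.CondFalse[of e r c2 n r' c1] eq
    by (intro exI[of _ r'] exI[of _ "1 + eval_cost e r + n"]) (auto split: if_splits)
qed

lemma steps_WhileFalse:
  assumes e: "expr_vars e \<subseteq> {N<..}" "eval e s = Leaf"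
  shows "steps N (While e c) s (1 + eval_cost e s) s"
  unfolding steps_def
proof (intro allI impI)
  fix r assume r: "\<forall>i>N. r i = s i"
  have "eval e r = eval e s" "eval_cost e r = eval_cost e s"
    using e(1) r by (auto intro!: eval_cong eval_cost_cong)
  with e have "exec (While e c) r (1 + eval_cost e s) r" using exec.WhileFalse[of e r c] by simp
  with r show "\<exists>r' n. exec (While e c) r n r' \<and> n \<le> 1 + eval_cost e s \<and> (\<forall>i>N. r' i = s i)" by blast
qed

lemma steps_WhileTrue:
  assumes e: "expr_vars e \<subseteq> {N<..}" "eval e s \<noteq> Leaf"
    and c: "steps N c s b1 s1" "steps N (While e c) s1 b2 s2"
  shows "steps N (While e c) s (1 + eval_cost e s + b1 + b2) s2"
  unfolding steps_def
proof (intro allI impI)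
  fix r assume r: "\<forall>i>N. r i = s i"
  have eq: "eval e r = eval e s" "eval_cost e r = eval_cost e s"
    using e(1) r by (auto intro!: eval_cong eval_cost_cong)
  obtain r1 n1 where 1: "exec c r n1 r1" "n1 \<le> b1" "\<forall>i>N. r1 i = s1 i"
    using c(1) r unfolding steps_def by blast
  then obtain r2 n2 where 2: "exec (While e c) r1 n2 r2" "n2 \<le> b2" "\<forall>i>N. r2 i = s2 i"
    using c(2) unfolding steps_def by blast
  show "\<exists>r' n. exec (While e c) r n r' \<and> n \<le> 1 + eval_cost e s + b1 + b2 \<and> (\<forall>i>N. r' i = s2 i)"
    using exec.WhileTrue[of e r c n1 r1 n2 r2] 1 2 eq e(2)
    by (intro exI[of _ r2] exI[of _ "1 + eval_cost e r + n1 + n2"]) auto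
qed

section \<open>Calling programs as subroutines\<close>

fun clear :: "nat \<Rightarrow> com" where
  "clear 0 = Assign 0 ELeaf"
| "clear (Suc n) = Seq (clear n) (Assign (Suc n) ELeaf)"

lemma exec_clear: "exec (clear N) s (2 * (N + 1)) (\<lambda>i. if i \<le> N then Leaf else s i)"
proof (induction N)
  case 0
  have "s(0 := Leaf) = (\<lambda>i. if i \<le> 0 then Leaf else s i)" by auto
  then show ?case using exec.Assign[of 0 ELeaf s] by (simp add: numeral_2_eq_2)
next
  case (Suc N)
  have "(\<lambda>i. if i \<le> N then Leaf else s i)(Suc N := Leaf) = (\<lambda>i. if i \<le> Suc N then Leaf else s i)"
    by auto
  then show ?case using exec.Seq[OF Suc exec.Assign[of "Suc N" ELeaf]] by simp
qed

definition call :: "nat \<Rightarrow> com \<Rightarrow> expr \<Rightarrow> nat \<Rightarrow> com" where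
  "call N c e k = Seq (clear N) (Seq (Assign 0 e) (Seq c (Assign k (EVar 0))))"

lemma steps_call:
  assumes c: "computes_in c (eval e s) y n" "com_vars c \<subseteq> {..N}" and e: "expr_vars e \<subseteq> {N<..}" and k: "N < k"
  shows "steps N (call N c e k) s (2 * (N + 1) + 3 + eval_cost e s + n + size y) (s(k := y))"
  unfolding steps_def
proof (intro allI impI)
  fix r assume r: "\<forall>i>N. r i = s i"
  \<comment> \<open>The argument is evaluated after the erasure, which is harmless because
    \<open>e\<close> reads only variables above \<open>N\<close>.\<close>
  define r1 where "r1 = (\<lambda>i. if i \<le> N then Leaf else r i)"
  have eq: "eval e r1 = eval e s" "eval_cost e r1 = eval_cost e s"
    using e r by (auto intro!: eval_cong eval_cost_cong simp: r1_def)
  obtain s' where s': "exec c ((\<lambda>_. Leaf)(0 := eval e s)) n s'" "s' 0 = y"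
    using c(1) by (auto simp: computes_in_def)
  have "((\<lambda>_. Leaf)(0 := eval e s)) x = (r1(0 := eval e s)) x" if "x \<in> {..N}" for x
    using that by (simp add: r1_def)
  from exec_frame[OF s'(1) c(2) this]
  obtain r2 where r2: "exec c (r1(0 := eval e s)) n r2" "\<forall>x\<in>{..N}. s' x = r2 x"
      "\<forall>x. x \<notin> {..N} \<longrightarrow> r2 x = (r1(0 := eval e s)) x"
    by blast
  have "r2 0 = y" using r2(2) s'(2) by auto
  have "exec (call N c e k) r (2 * (N + 1) + ((1 + eval_cost e r1) + (n + (1 + eval_cost (EVar 0) r2))))
      (r2(k := eval (EVar 0) r2))"
    using exec.Seq[OF exec_clear[of N r, folded r1_def]
        exec.Seq[OF exec.Assign exec.Seq[OF r2(1)[folded eq(1)] exec.Assign]]]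
    unfolding call_def .
  moreover have "2 * (N + 1) + ((1 + eval_cost e r1) + (n + (1 + eval_cost (EVar 0) r2)))
      \<le> 2 * (N + 1) + 3 + eval_cost e s + n + size y"
    using eq \<open>r2 0 = y\<close> by simp
  moreover have "\<forall>i>N. (r2(k := eval (EVar 0) r2)) i = (s(k := y)) i"
    using \<open>r2 0 = y\<close> r2(3) r by (auto simp: r1_def)
  ultimately show "\<exists>r' n'. exec (call N c e k) r n' r' \<and> n' \<le> 2 * (N + 1) + 3 + eval_cost e s + n + size y \<and>
      (\<forall>i>N. r' i = (s(k := y)) i)" by blast
qed

section \<open>Polynomial bounds and polynomial-time functions\<close>

definition poly_bounded :: "(nat \<Rightarrow> nat) \<Rightarrow> bool" where
  "poly_bounded B \<longleftrightarrow> (\<exists>p. \<forall>n. B n \<le> poly p n)"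

lemma poly_nat_mono: "x \<le> y \<Longrightarrow> poly p x \<le> poly (p :: nat poly) y"
  by (induction p) (auto intro: mult_mono add_mono)

lemma poly_bounded_const: "poly_bounded (\<lambda>n. k)"
  unfolding poly_bounded_def by (rule exI[of _ "[:k:]"]) simp

lemma poly_bounded_id: "poly_bounded (\<lambda>n. n)"
  unfolding poly_bounded_def by (rule exI[of _ "[:0, 1:]"]) simp

lemma poly_bounded_add: "poly_bounded f \<Longrightarrow> poly_bounded g \<Longrightarrow> poly_bounded (\<lambda>n. f n + g n)"
  unfolding poly_bounded_def by (metis add_mono poly_add)

lemma poly_bounded_mult: "poly_bounded f \<Longrightarrow> poly_bounded g \<Longrightarrow> poly_bounded (\<lambda>n. f n * g n)"
  unfolding poly_bounded_def by (metis mult_le_mono poly_mult)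

lemma poly_bounded_poly: "poly_bounded f \<Longrightarrow> poly_bounded (\<lambda>n. poly p (f n))"
  unfolding poly_bounded_def by (metis poly_nat_mono poly_pcompose)

lemma poly_bounded_Suc: "poly_bounded f \<Longrightarrow> poly_bounded (\<lambda>n. Suc (f n))"
  using poly_bounded_add[OF poly_bounded_const[of 1]] by simp

lemmas poly_bounded_intros = poly_bounded_id poly_bounded_const poly_bounded_add poly_bounded_mult
  poly_bounded_poly poly_bounded_Suc

text \<open>The domain \<open>D\<close> is a promise: nothing is asked of the program outside it.
  Thus the choice made by a program that is trusted only on valid instances with one event can count
  as polynomial-time.\<close>

definition polytime :: "'a set \<Rightarrow> ('a \<Rightarrow> data) \<Rightarrow> ('b \<Rightarrow> data) \<Rightarrow> ('a \<Rightarrow> 'b) \<Rightarrow> bool" where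
  "polytime D ea eb f \<longleftrightarrow> (\<exists>c p. \<forall>x\<in>D. \<exists>n. computes_in c (ea x) (eb (f x)) n \<and> n \<le> poly p (size (ea x)))"

lemma polytimeI_computes:
  assumes "poly_bounded B" "\<And>x. x \<in> D \<Longrightarrow> \<exists>n. computes_in c (ea x) (eb (f x)) n \<and> n \<le> B (size (ea x))"
  shows "polytime D ea eb f"
  using assms unfolding polytime_def poly_bounded_def by (meson order_trans)

text \<open>\<open>C\<close> generates code from an argument expression and a target variable, with
  scratch memory up to \<open>M\<close>. The output size is bounded as well, so that later calls on
  the result can be timed.\<close>

definition subroutine ::
    "nat \<Rightarrow> (expr \<Rightarrow> nat \<Rightarrow> com) \<Rightarrow> nat poly \<Rightarrow> 'a set \<Rightarrow> ('a \<Rightarrow> data) \<Rightarrow> ('b \<Rightarrow> data) \<Rightarrow> ('a \<Rightarrow> 'b) \<Rightarrow> bool" where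
  "subroutine M C p D ea eb f \<longleftrightarrow> (\<forall>x\<in>D. size (eb (f x)) \<le> poly p (size (ea x)) \<and>
    (\<forall>e k s. expr_vars e \<subseteq> {M<..} \<longrightarrow> M < k \<longrightarrow> eval e s = ea x \<longrightarrow>
       steps M (C e k) s (poly p (size (ea x)) + eval_cost e s) (s(k := eb (f x)))))"

lemma subroutine_size: "subroutine M C p D ea eb f \<Longrightarrow> x \<in> D \<Longrightarrow> size (eb (f x)) \<le> poly p (size (ea x))"
  by (simp add: subroutine_def)

lemma subroutine_steps:
  "subroutine M C p D ea eb f \<Longrightarrow> x \<in> D \<Longrightarrow> expr_vars e \<subseteq> {M<..} \<Longrightarrow> M < k \<Longrightarrow> eval e s = ea x \<Longrightarrow>
     steps M (C e k) s (poly p (size (ea x)) + eval_cost e s) (s(k := eb (f x)))"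
  by (simp add: subroutine_def)

lemma polytime_subroutine:
  assumes "polytime D ea eb f"
  shows "\<exists>N. \<forall>M\<ge>N. \<exists>C p. subroutine M C p D ea eb f"
proof -
  obtain c p where c: "\<And>x. x \<in> D \<Longrightarrow> \<exists>n. computes_in c (ea x) (eb (f x)) n \<and> n \<le> poly p (size (ea x))"
    using assms unfolding polytime_def by blast
  obtain N where N: "com_vars c \<subseteq> {..N}"
    using finite_com_vars finite_nat_iff_bounded_le by blast
  have "\<exists>C q. subroutine M C q D ea eb f" if "N \<le> M" for M
  proof -
    have M: "com_vars c \<subseteq> {..M}" using N that by auto
    have "poly_bounded (\<lambda>n. 2 * (M + 1) + 3 + poly p n + (n + poly p n))"
      by (intro poly_bounded_intros)
    then obtain q where q: "\<And>n. 2 * (M + 1) + 3 + poly p n + (n + poly p n) \<le> poly q n"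
      unfolding poly_bounded_def by blast
    have "subroutine M (call M c) q D ea eb f"
      unfolding subroutine_def
    proof (intro ballI conjI allI impI)
      fix x assume x: "x \<in> D"
      obtain n where n: "computes_in c (ea x) (eb (f x)) n" "n \<le> poly p (size (ea x))"
        using c[OF x] by blast
      obtain s' where s': "exec c ((\<lambda>_. Leaf)(0 := ea x)) n s'" "s' 0 = eb (f x)"
        using n(1) by (auto simp: computes_in_def)
      have "size (s' 0) \<le> size (ea x) + n" by (rule exec_size[OF s'(1)]) simp
      with n(2) s'(2) have sz: "size (eb (f x)) \<le> size (ea x) + poly p (size (ea x))" by simp
      then show "size (eb (f x)) \<le> poly q (size (ea x))" using q[of "size (ea x)"] by linarith
      fix e k s assume e: "expr_vars e \<subseteq> {M<..}" "M < k" "eval e s = ea x"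
      have "steps M (call M c e k) s (2 * (M + 1) + 3 + eval_cost e s + n + size (eb (f x))) (s(k := eb (f x)))"
        using n(1) e by (intro steps_call M) simp_all
      then show "steps M (call M c e k) s (poly q (size (ea x)) + eval_cost e s) (s(k := eb (f x)))"
        by (rule steps_mono) (use n(2) sz q[of "size (ea x)"] in linarith)
    qed
    then show ?thesis by blast
  qed
  then show ?thesis by blast
qed

lemma polytime_subroutine2:
  assumes "polytime D ea eb f" "polytime D' ec ed g"
  obtains M C p C' p' where "subroutine M C p D ea eb f" "subroutine M C' p' D' ec ed g"
  using polytime_subroutine[OF assms(1)] polytime_subroutine[OF assms(2)] by (meson max.cobounded1 max.cobounded2)

lemma polytime_subroutine3:
  assumes "polytime D ea eb f" "polytime D' ec ed g" "polytime D'' ee ef h"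
  obtains M C p C' p' C'' p'' where "subroutine M C p D ea eb f" "subroutine M C' p' D' ec ed g"
    "subroutine M C'' p'' D'' ee ef h"
proof -
  obtain N N' N'' where N: "\<And>M. M \<ge> N \<Longrightarrow> \<exists>C p. subroutine M C p D ea eb f"
      "\<And>M. M \<ge> N' \<Longrightarrow> \<exists>C p. subroutine M C p D' ec ed g"
      "\<And>M. M \<ge> N'' \<Longrightarrow> \<exists>C p. subroutine M C p D'' ee ef h"
    using assms[THEN polytime_subroutine] by blast
  then show ?thesis
    using that N[of "N + N' + N''"] by (meson le_add1 le_add2 trans_le_add1)
qed

text \<open>Calling convention of the programs below: argument in variable \<open>N + 1\<close>,
  result in \<open>N + 2\<close>. The wrapper adds the copies from and to variable 0;
  \<open>exec_size\<close> bounds the cost of copying the result.\<close>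

lemma polytimeI:
  assumes B: "poly_bounded B"
    and P: "\<And>x. x \<in> D \<Longrightarrow> \<exists>s'. steps N P ((\<lambda>_. Leaf)(N + 1 := ea x)) (B (size (ea x))) s' \<and> s' (N + 2) = eb (f x)"
  shows "polytime D ea eb f"
proof (rule polytimeI_computes)
  show "poly_bounded (\<lambda>n. (2 + n) + (B n + (2 + (n + (2 + n) + B n))))"
    by (intro poly_bounded_intros B)
  fix x assume "x \<in> D"
  from P[OF this] obtain s' where s': "steps N P ((\<lambda>_. Leaf)(N + 1 := ea x)) (B (size (ea x))) s'"
      "s' (N + 2) = eb (f x)" by blast
  let ?s0 = "(\<lambda>_. Leaf)(0 := ea x)" let ?s1 = "?s0(N + 1 := ea x)"
  obtain r n where r: "exec P ?s1 n r" "n \<le> B (size (ea x))" "r (N + 2) = eb (f x)"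
    using s' unfolding steps_def by (elim allE[of _ ?s1]) auto
  let ?c = "Seq (Assign (N + 1) (EVar 0)) (Seq P (Assign 0 (EVar (N + 2))))"
  have 1: "exec (Seq (Assign (N + 1) (EVar 0)) P) ?s0 ((2 + size (ea x)) + n) r"
    using exec.Seq[OF exec.Assign[of "N + 1" "EVar 0" ?s0], of P n r] r(1) by simp
  have "size (eb (f x)) \<le> size (ea x) + ((2 + size (ea x)) + n)"
    unfolding r(3)[symmetric] by (rule exec_size[OF 1]) auto
  moreover have "exec ?c ?s0 ((1 + eval_cost (EVar 0) ?s0) + (n + (1 + eval_cost (EVar (N + 2)) r)))
      (r(0 := eval (EVar (N + 2)) r))"
    using r(1) by (intro exec.Seq[OF exec.Assign] exec.Seq[OF _ exec.Assign]) simp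
  then have "exec ?c ?s0 ((2 + size (ea x)) + (n + (2 + size (eb (f x))))) (r(0 := eb (f x)))"
    using r(3) by simp
  ultimately show "\<exists>n. computes_in ?c (ea x) (eb (f x)) n \<and> n \<le> (2 + size (ea x)) + (B (size (ea x)) + (2 +
      (size (ea x) + (2 + size (ea x)) + B (size (ea x)))))"
    unfolding computes_in_def using r(2)
    by (intro exI[of _ "(2 + size (ea x)) + (n + (2 + size (eb (f x))))"] conjI exI[of _ "r(0 := eb (f x))"])
       auto
qed

text \<open>The identity is a legitimate encoding of \<open>data\<close>; only the encoded values matter.\<close>

lemma polytime_recode:
  assumes "polytime D ea eb f" "\<And>x. x \<in> D \<Longrightarrow> eb (f x) = ec (g x)"
  shows "polytime D ea ec g"
  using assms unfolding polytime_def by simp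

lemma polytime_size:
  assumes "polytime D ea eb f"
  obtains p where "\<And>x. x \<in> D \<Longrightarrow> size (eb (f x)) \<le> poly p (size (ea x))"
  using polytime_subroutine[OF assms] subroutine_size by (metis order_refl)

lemma polytime_comp:
  assumes g: "polytime D' eb ec g" and f: "polytime D ea eb f" and D: "\<And>x. x \<in> D \<Longrightarrow> f x \<in> D'"
  shows "polytime D ea ec (\<lambda>x. g (f x))"
proof -
  obtain M C1 p1 C2 p2 where 1: "subroutine M C1 p1 D ea eb f" and 2: "subroutine M C2 p2 D' eb ec g"
    using polytime_subroutine2[OF f g] by blast
  let ?B = "\<lambda>n. (poly p1 n + (1 + n)) + (poly p2 (poly p1 n) + (1 + poly p1 n))"
  show ?thesis
  proof (rule polytimeI[where N = M and B = ?B])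
    show "poly_bounded ?B" by (intro poly_bounded_intros)
    fix x assume x: "x \<in> D"
    let ?s = "(\<lambda>_. Leaf)(M + 1 := ea x)"
    let ?s1 = "?s(M + 3 := eb (f x))" let ?s2 = "?s1(M + 2 := ec (g (f x)))"
    have s1: "steps M (C1 (EVar (M + 1)) (M + 3)) ?s (poly p1 (size (ea x)) + (1 + size (ea x))) ?s1"
      using subroutine_steps[OF 1 x, of "EVar (M + 1)" "M + 3" ?s] by simp
    have "steps M (C2 (EVar (M + 3)) (M + 2)) ?s1 (poly p2 (size (eb (f x))) + (1 + size (eb (f x)))) ?s2"
      using subroutine_steps[OF 2 D[OF x], of "EVar (M + 3)" "M + 2" ?s1] by simp
    then have s2: "steps M (C2 (EVar (M + 3)) (M + 2)) ?s1
        (poly p2 (poly p1 (size (ea x))) + (1 + poly p1 (size (ea x)))) ?s2"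
      by (rule steps_mono) (use subroutine_size[OF 1 x] poly_nat_mono[OF subroutine_size[OF 1 x], of p2] in linarith)
    show "\<exists>s'. steps M (Seq (C1 (EVar (M + 1)) (M + 3)) (C2 (EVar (M + 3)) (M + 2))) ?s (?B (size (ea x))) s' \<and>
        s' (M + 2) = ec (g (f x))"
      by (rule exI[of _ ?s2], rule conjI[OF steps_Seq[OF s1 s2]]) simp
  qed
qed

lemma polytime_Node:
  assumes f: "polytime D ea eb f" and g: "polytime D ea ec g"
  shows "polytime D ea (\<lambda>d. d) (\<lambda>x. Node (eb (f x)) (ec (g x)))"
proof -
  obtain M C1 p1 C2 p2 where 1: "subroutine M C1 p1 D ea eb f" and 2: "subroutine M C2 p2 D ea ec g"
    using polytime_subroutine2[OF f g] by blast
  let ?B = "\<lambda>n. (poly p1 n + (1 + n)) + ((poly p2 n + (1 + n)) + (5 + 2 * poly p1 n + 2 * poly p2 n))"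
  show ?thesis
  proof (rule polytimeI[where N = M and B = ?B])
    show "poly_bounded ?B" by (intro poly_bounded_intros)
    fix x assume x: "x \<in> D"
    let ?s = "(\<lambda>_. Leaf)(M + 1 := ea x)"
    let ?s1 = "?s(M + 3 := eb (f x))" let ?s2 = "?s1(M + 4 := ec (g x))"
    let ?e = "ENode (EVar (M + 3)) (EVar (M + 4))"
    let ?s3 = "?s2(M + 2 := eval ?e ?s2)"
    have s1: "steps M (C1 (EVar (M + 1)) (M + 3)) ?s (poly p1 (size (ea x)) + (1 + size (ea x))) ?s1"
      using subroutine_steps[OF 1 x, of "EVar (M + 1)" "M + 3" ?s] by simp
    have s2: "steps M (C2 (EVar (M + 1)) (M + 4)) ?s1 (poly p2 (size (ea x)) + (1 + size (ea x))) ?s2"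
      using subroutine_steps[OF 2 x, of "EVar (M + 1)" "M + 4" ?s1] by simp
    have s3: "steps M (Assign (M + 2) ?e) ?s2 (5 + 2 * poly p1 (size (ea x)) + 2 * poly p2 (size (ea x))) ?s3"
      by (rule steps_mono[OF steps_Assign]) (use subroutine_size[OF 1 x] subroutine_size[OF 2 x] in auto)
    show "\<exists>s'. steps M (Seq (C1 (EVar (M + 1)) (M + 3)) (Seq (C2 (EVar (M + 1)) (M + 4)) (Assign (M + 2) ?e))) ?s
        (?B (size (ea x))) s' \<and> s' (M + 2) = Node (eb (f x)) (ec (g x))"
      by (rule exI[of _ ?s3], rule conjI[OF steps_Seq[OF s1 steps_Seq[OF s2 s3]]]) simp
  qed
qed

lemma polytime_if:
  assumes b: "polytime D ea data_of_bool b" and f: "polytime D ea eb f" and g: "polytime D ea eb g"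
  shows "polytime D ea eb (\<lambda>x. if b x then f x else g x)"
proof -
  obtain M C0 p0 C1 p1 C2 p2 where 0: "subroutine M C0 p0 D ea data_of_bool b"
      and 1: "subroutine M C1 p1 D ea eb f" and 2: "subroutine M C2 p2 D ea eb g"
    using polytime_subroutine3[OF b f g] by blast
  let ?B = "\<lambda>n. (poly p0 n + (1 + n)) + (3 + (poly p1 n + poly p2 n + (1 + n)))"
  show ?thesis
  proof (rule polytimeI[where N = M and B = ?B])
    show "poly_bounded ?B" by (intro poly_bounded_intros)
    fix x assume x: "x \<in> D"
    let ?n = "size (ea x)" and ?s = "(\<lambda>_. Leaf)(M + 1 := ea x)"
    let ?s1 = "?s(M + 3 := data_of_bool (b x))"
    let ?s2 = "?s1(M + 2 := eb (if b x then f x else g x))"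
    have s1: "steps M (C0 (EVar (M + 1)) (M + 3)) ?s (poly p0 ?n + (1 + ?n)) ?s1"
      using subroutine_steps[OF 0 x, of "EVar (M + 1)" "M + 3" ?s] by simp
    have "steps M (if eval (EVar (M + 3)) ?s1 \<noteq> Leaf then C1 (EVar (M + 1)) (M + 2) else C2 (EVar (M + 1)) (M + 2))
        ?s1 (poly p1 ?n + poly p2 ?n + (1 + ?n)) ?s2"
      using subroutine_steps[OF 1 x, of "EVar (M + 1)" "M + 2" ?s1] subroutine_steps[OF 2 x, of "EVar (M + 1)" "M + 2" ?s1]
      by (cases "b x") (auto simp: data_of_bool_def elim: steps_mono)
    then have "steps M (Cond (EVar (M + 3)) (C1 (EVar (M + 1)) (M + 2)) (C2 (EVar (M + 1)) (M + 2)))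
        ?s1 (1 + eval_cost (EVar (M + 3)) ?s1 + (poly p1 ?n + poly p2 ?n + (1 + ?n))) ?s2"
      by (intro steps_Cond) auto
    then have s2: "steps M (Cond (EVar (M + 3)) (C1 (EVar (M + 1)) (M + 2)) (C2 (EVar (M + 1)) (M + 2)))
        ?s1 (3 + (poly p1 ?n + poly p2 ?n + (1 + ?n))) ?s2"
      by (rule steps_mono) (simp add: data_of_bool_def)
    show "\<exists>s'. steps M (Seq (C0 (EVar (M + 1)) (M + 3))
        (Cond (EVar (M + 3)) (C1 (EVar (M + 1)) (M + 2)) (C2 (EVar (M + 1)) (M + 2)))) ?s (?B ?n) s' \<and>
        s' (M + 2) = eb (if b x then f x else g x)"
      by (rule exI[of _ ?s2], rule conjI[OF steps_Seq[OF s1 s2]]) simp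
  qed
qed

fun enc_pair :: "('a \<Rightarrow> data) \<Rightarrow> ('b \<Rightarrow> data) \<Rightarrow> 'a \<times> 'b \<Rightarrow> data" where
  "enc_pair ea eb (x, y) = Node (ea x) (eb y)"

lemma length_le_size_enc_list: "length xs \<le> size (enc_list e xs)"
  by (induction xs) auto

lemma size_enc_list_mem: "x \<in> set xs \<Longrightarrow> size (e x) \<le> size (enc_list e xs)"
  by (induction xs) auto

lemma size_enc_list_append: "size (enc_list e (xs @ ys)) = size (enc_list e xs) + size (enc_list e ys)"
  by (induction xs) auto

lemma size_enc_list_le:
  "(\<And>x. x \<in> set xs \<Longrightarrow> size (e x) \<le> B) \<Longrightarrow> size (enc_list e xs) \<le> length xs * (B + 1)"
proof (induction xs)
  case (Cons a xs)
  then have "size (e a) \<le> B" "size (enc_list e xs) \<le> length xs * (B + 1)" by auto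
  then show ?case by simp
qed simp

text \<open>Iterating a polynomial-time step can blow up the accumulator, so a bound
  \<open>B\<close> on all intermediate accumulators is required. The domain \<open>D'\<close> has to
  contain only states that arise in the loop.\<close>

lemma polytime_foldl:
  assumes g: "polytime D' (enc_pair ea (enc_pair ee ec)) ec (\<lambda>z. g (fst z) (snd (snd z)) (fst (snd z)))"
    and l: "polytime D ea (enc_list ee) l" and a: "polytime D ea ec a"
    and D': "\<And>x pre e post. x \<in> D \<Longrightarrow> l x = pre @ e # post \<Longrightarrow> (x, e, foldl (g x) (a x) pre) \<in> D'"
    and B: "poly_bounded B"
    and sz: "\<And>x pre post. x \<in> D \<Longrightarrow> l x = pre @ post \<Longrightarrow> size (ec (foldl (g x) (a x) pre)) \<le> B (size (ea x))"
  shows "polytime D ea ec (\<lambda>x. foldl (g x) (a x) (l x))"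
proof -
  obtain M C0 p0 C1 p1 C2 p2
    where 0: "subroutine M C0 p0 D' (enc_pair ea (enc_pair ee ec)) ec (\<lambda>z. g (fst z) (snd (snd z)) (fst (snd z)))"
      and 1: "subroutine M C1 p1 D ea (enc_list ee) l" and 2: "subroutine M C2 p2 D ea ec a"
    using polytime_subroutine3[OF g l a] by blast
  let ?e = "ENode (EVar (M + 1)) (ENode (EHd (EVar (M + 3))) (EVar (M + 2)))"
  let ?body = "Seq (C0 ?e (M + 2)) (Assign (M + 3) (ETl (EVar (M + 3))))"
  let ?loop = "While (EVar (M + 3)) ?body"
  \<comment> \<open>Bound for one pass of the loop, test included;
    \<open>2 + n + poly p1 n + B n\<close> bounds the argument of the step, with two nodes for the
    nested pair.\<close>
  define K where "K = (\<lambda>n. 20 + poly p0 (2 + n + poly p1 n + B n) + 2 * n + 8 * poly p1 n + 3 * B n)"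
  let ?B = "\<lambda>n. (poly p1 n + (1 + n)) + ((poly p2 n + (1 + n)) + (poly p1 n + 1) * K n)"
  \<comment> \<open>Loop invariant: \<open>M + 3\<close> holds the unread list and
    \<open>M + 2\<close> the fold over the prefix already read. One extra \<open>K\<close> pays for
    the failing last test.\<close>
  have loop: "\<exists>s'. steps M ?loop s ((length post + 1) * K (size (ea x))) s' \<and>
      s' (M + 2) = ec (foldl (g x) (a x) (l x))"
    if x: "x \<in> D" and "l x = pre @ post" "s (M + 1) = ea x" "s (M + 3) = enc_list ee post"
      "s (M + 2) = ec (foldl (g x) (a x) pre)" for x pre post s
    using that(2-)
  proof (induction post arbitrary: pre s)
    case Nil
    have "steps M ?loop s (1 + eval_cost (EVar (M + 3)) s) s"
      using Nil by (intro steps_WhileFalse) auto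
    then have "steps M ?loop s ((length [] + 1) * K (size (ea x))) s"
      by (rule steps_mono) (use Nil in \<open>simp add: K_def\<close>)
    with Nil show ?case by auto
  next
    case (Cons e post)
    let ?n = "size (ea x)" and ?acc = "foldl (g x) (a x) pre"
    let ?z = "(x, e, ?acc)"
    have rest: "size (ee e) + size (enc_list ee post) + 1 \<le> poly p1 ?n"
      using subroutine_size[OF 1 x] Cons.prems(1) by (simp add: size_enc_list_append)
    have acc: "size (ec ?acc) \<le> B ?n" by (rule sz[OF x Cons.prems(1)])
    have z: "?z \<in> D'" using D'[OF x Cons.prems(1)] .
    let ?s1 = "s(M + 2 := ec (g x ?acc e))"
    let ?s2 = "?s1(M + 3 := eval (ETl (EVar (M + 3))) ?s1)"
    have "steps M (C0 ?e (M + 2)) s (poly p0 (size (enc_pair ea (enc_pair ee ec) ?z)) + eval_cost ?e s) ?s1"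
      using subroutine_steps[OF 0 z, of ?e "M + 2" s] Cons.prems by simp
    moreover have "poly p0 (size (enc_pair ea (enc_pair ee ec) ?z)) \<le> poly p0 (2 + ?n + poly p1 ?n + B ?n)"
      using rest acc by (intro poly_nat_mono) simp
    moreover have "eval_cost ?e s \<le> 10 + 2 * ?n + 4 * poly p1 ?n + 3 * B ?n"
      using Cons.prems rest acc by simp
    ultimately have s1: "steps M (C0 ?e (M + 2)) s
        (poly p0 (2 + ?n + poly p1 ?n + B ?n) + (10 + 2 * ?n + 4 * poly p1 ?n + 3 * B ?n)) ?s1"
      by (elim steps_mono) linarith
    have s2: "steps M (Assign (M + 3) (ETl (EVar (M + 3)))) ?s1 (4 + 2 * poly p1 ?n) ?s2"
      by (rule steps_mono[OF steps_Assign]) (use Cons.prems rest in auto)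
    have "\<exists>s'. steps M ?loop ?s2 ((length post + 1) * K ?n) s' \<and> s' (M + 2) = ec (foldl (g x) (a x) (l x))"
      by (rule Cons.IH[of "pre @ [e]"]) (use Cons.prems in auto)
    then obtain s' where s': "steps M ?loop ?s2 ((length post + 1) * K ?n) s'"
        "s' (M + 2) = ec (foldl (g x) (a x) (l x))" by blast
    have "steps M ?loop s (1 + eval_cost (EVar (M + 3)) s +
        ((poly p0 (2 + ?n + poly p1 ?n + B ?n) + (10 + 2 * ?n + 4 * poly p1 ?n + 3 * B ?n)) + (4 + 2 * poly p1 ?n)) +
        (length post + 1) * K ?n) s'"
      by (rule steps_WhileTrue[OF _ _ steps_Seq[OF s1 s2] s'(1)]) (use Cons.prems in auto)
    then have "steps M ?loop s ((length (e # post) + 1) * K ?n) s'"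
      by (rule steps_mono) (use Cons.prems rest in \<open>simp add: K_def\<close>)
    with s'(2) show ?case by blast
  qed
  show ?thesis
  proof (rule polytimeI[where N = M and B = ?B])
    show "poly_bounded ?B" unfolding K_def by (intro poly_bounded_intros B)
    fix x assume x: "x \<in> D"
    let ?n = "size (ea x)" and ?s = "(\<lambda>_. Leaf)(M + 1 := ea x)"
    let ?s1 = "?s(M + 3 := enc_list ee (l x))" let ?s2 = "?s1(M + 2 := ec (a x))"
    have s1: "steps M (C1 (EVar (M + 1)) (M + 3)) ?s (poly p1 ?n + (1 + ?n)) ?s1"
      using subroutine_steps[OF 1 x, of "EVar (M + 1)" "M + 3" ?s] by simp
    have s2: "steps M (C2 (EVar (M + 1)) (M + 2)) ?s1 (poly p2 ?n + (1 + ?n)) ?s2"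
      using subroutine_steps[OF 2 x, of "EVar (M + 1)" "M + 2" ?s1] by simp
    have "\<exists>s'. steps M ?loop ?s2 ((length (l x) + 1) * K ?n) s' \<and> s' (M + 2) = ec (foldl (g x) (a x) (l x))"
      by (rule loop[OF x, of "[]"]) auto
    then obtain s' where s': "steps M ?loop ?s2 ((length (l x) + 1) * K ?n) s'"
        "s' (M + 2) = ec (foldl (g x) (a x) (l x))" by blast
    have "(length (l x) + 1) * K ?n \<le> (poly p1 ?n + 1) * K ?n"
      using subroutine_size[OF 1 x] length_le_size_enc_list[of "l x" ee] by (intro mult_right_mono) auto
    from steps_mono[OF s'(1) this] have
      "steps M (Seq (C1 (EVar (M + 1)) (M + 3)) (Seq (C2 (EVar (M + 1)) (M + 2)) ?loop)) ?s (?B ?n) s'"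
      by (intro steps_Seq[OF s1] steps_Seq[OF s2])
    with s'(2) show "\<exists>s'. steps M (Seq (C1 (EVar (M + 1)) (M + 3)) (Seq (C2 (EVar (M + 1)) (M + 2)) ?loop)) ?s (?B ?n) s' \<and>
        s' (M + 2) = ec (foldl (g x) (a x) (l x))" by blast
  qed
qed

section \<open>Closure properties of polynomial time\<close>

lemma polytime_expr:
  assumes "poly_bounded B"
    and "\<And>x. x \<in> D \<Longrightarrow> eval e ((\<lambda>_. Leaf)(0 := ea x)) = eb (f x) \<and>
      eval_cost e ((\<lambda>_. Leaf)(0 := ea x)) \<le> B (size (ea x))"
  shows "polytime D ea eb f"
proof (rule polytimeI_computes)
  show "poly_bounded (\<lambda>n. 1 + B n)" by (intro poly_bounded_intros assms(1))
  fix x assume x: "x \<in> D"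
  let ?s = "(\<lambda>_. Leaf)(0 := ea x)"
  have "exec (Assign 0 e) ?s (1 + eval_cost e ?s) (?s(0 := eval e ?s))" by (rule exec.Assign)
  with assms(2)[OF x] show "\<exists>n. computes_in (Assign 0 e) (ea x) (eb (f x)) n \<and> n \<le> 1 + B (size (ea x))"
    unfolding computes_in_def by (metis add_le_cancel_left fun_upd_same)
qed

lemma polytime_id: "polytime D ea ea (\<lambda>x. x)"
  by (rule polytime_expr[where e = "EVar 0" and B = "\<lambda>n. 1 + n"]) (auto intro!: poly_bounded_intros)

lemma size_data_hd: "size (data_hd d) \<le> size d" and size_data_tl: "size (data_tl d) \<le> size d"
  by (cases d; simp)+

lemma polytime_data_hd:
  assumes "polytime D ea eb f" "\<And>x. x \<in> D \<Longrightarrow> data_hd (eb (f x)) = ec (g x)"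
  shows "polytime D ea ec g"
proof -
  have hd: "polytime UNIV (\<lambda>d. d) (\<lambda>d. d) data_hd"
    by (rule polytime_expr[where e = "EHd (EVar 0)" and B = "\<lambda>n. 2 + n + n"])
       (use size_data_hd in \<open>auto intro!: poly_bounded_intros\<close>)
  have "polytime D ea (\<lambda>d. d) (\<lambda>x. eb (f x))" by (rule polytime_recode[OF assms(1)]) simp
  from polytime_recode[OF polytime_comp[OF hd this], of ec g] assms(2) show ?thesis by simp
qed

lemma polytime_data_tl:
  assumes "polytime D ea eb f" "\<And>x. x \<in> D \<Longrightarrow> data_tl (eb (f x)) = ec (g x)"
  shows "polytime D ea ec g"
proof -
  have tl: "polytime UNIV (\<lambda>d. d) (\<lambda>d. d) data_tl"
    by (rule polytime_expr[where e = "ETl (EVar 0)" and B = "\<lambda>n. 2 + n + n"])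
       (use size_data_tl in \<open>auto intro!: poly_bounded_intros\<close>)
  have "polytime D ea (\<lambda>d. d) (\<lambda>x. eb (f x))" by (rule polytime_recode[OF assms(1)]) simp
  from polytime_recode[OF polytime_comp[OF tl this], of ec g] assms(2) show ?thesis by simp
qed

text \<open>The language has no literal but the empty tree, so constants are assembled node by
  node.\<close>

fun quote :: "data \<Rightarrow> expr" where
  "quote Leaf = ELeaf"
| "quote (Node a b) = ENode (quote a) (quote b)"

lemma eval_quote: "eval (quote d) s = d"
  by (induction d) auto

lemma polytime_const: "polytime D ea eb (\<lambda>x. c)"
proof -
  have cost: "eval_cost (quote d) s = eval_cost (quote d) r" for d s r
    by (induction d) (auto simp: eval_quote)
  show ?thesis
  proof (rule polytime_expr)
    show "poly_bounded (\<lambda>n. eval_cost (quote (eb c)) (\<lambda>_. Leaf))" by (rule poly_bounded_const)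
    show "eval (quote (eb c)) s = eb c \<and> eval_cost (quote (eb c)) s \<le> eval_cost (quote (eb c)) (\<lambda>_. Leaf)" for s
      using cost[of "eb c" s "\<lambda>_. Leaf"] by (simp add: eval_quote)
  qed
qed

text \<open>The machine compares codes. Conclusions about values are drawn where the code determines
  the value, as for Booleans and for the number 0.\<close>

lemma polytime_eq_code:
  assumes "polytime D ea eb f" "polytime D ea ec g"
  shows "polytime D ea data_of_bool (\<lambda>x. eb (f x) = ec (g x))"
proof -
  have eq: "polytime UNIV (\<lambda>d. d) data_of_bool (\<lambda>d. data_hd d = data_tl d)"
  proof (rule polytime_expr)
    show "poly_bounded (\<lambda>n. 6 + n + n + n + n)" by (intro poly_bounded_intros)
    fix d
    show "eval (EEq (EHd (EVar 0)) (ETl (EVar 0))) ((\<lambda>_. Leaf)(0 := d)) = data_of_bool (data_hd d = data_tl d) \<and>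
        eval_cost (EEq (EHd (EVar 0)) (ETl (EVar 0))) ((\<lambda>_. Leaf)(0 := d)) \<le> 6 + size d + size d + size d + size d"
      using size_data_hd[of d] size_data_tl[of d] by (auto simp: data_of_bool_def)
  qed
  from polytime_comp[OF eq polytime_Node[OF assms]] show ?thesis by simp
qed

lemma polytime_not: "polytime D ea data_of_bool P \<Longrightarrow> polytime D ea data_of_bool (\<lambda>x. \<not> P x)"
  by (rule polytime_recode[OF polytime_if[of D ea P data_of_bool "\<lambda>_. False" "\<lambda>_. True"]])
     (auto intro: polytime_const)

lemma polytime_conj:
  "polytime D ea data_of_bool P \<Longrightarrow> polytime D ea data_of_bool Q \<Longrightarrow> polytime D ea data_of_bool (\<lambda>x. P x \<and> Q x)"
  by (rule polytime_recode[OF polytime_if[of D ea P data_of_bool Q "\<lambda>_. False"]])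
     (auto intro: polytime_const)

lemma polytime_disj:
  "polytime D ea data_of_bool P \<Longrightarrow> polytime D ea data_of_bool Q \<Longrightarrow> polytime D ea data_of_bool (\<lambda>x. P x \<or> Q x)"
  by (rule polytime_recode[OF polytime_if[of D ea P data_of_bool "\<lambda>_. True" Q]])
     (auto intro: polytime_const)

lemma polytime_noteq_bool:
  "polytime D ea data_of_bool P \<Longrightarrow> polytime D ea data_of_bool Q \<Longrightarrow> polytime D ea data_of_bool (\<lambda>x. P x \<noteq> Q x)"
  by (rule polytime_recode[OF polytime_not[OF polytime_eq_code[of D ea data_of_bool P data_of_bool Q]]])
     (auto simp: data_of_bool_def split: if_splits)

lemma polytime_Pair:
  assumes "polytime D ea eb f" "polytime D ea ec g"
  shows "polytime D ea (enc_pair eb ec) (\<lambda>x. (f x, g x))"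
  by (rule polytime_recode[OF polytime_Node[OF assms]]) simp

lemma polytime_fst: "polytime D ea (enc_pair eb ec) f \<Longrightarrow> polytime D ea eb (\<lambda>x. fst (f x))"
  by (rule polytime_data_hd, assumption) (metis data_hd.simps(2) enc_pair.simps prod.collapse)

lemma polytime_snd: "polytime D ea (enc_pair eb ec) f \<Longrightarrow> polytime D ea ec (\<lambda>x. snd (f x))"
  by (rule polytime_data_tl, assumption) (metis data_tl.simps(2) enc_pair.simps prod.collapse)

lemma polytime_Cons:
  assumes "polytime D ea e f" "polytime D ea (enc_list e) g"
  shows "polytime D ea (enc_list e) (\<lambda>x. f x # g x)"
  by (rule polytime_recode[OF polytime_Node[OF assms]]) simp

lemma polytime_hd:
  assumes "polytime D ea (enc_list e) f" "\<And>x. x \<in> D \<Longrightarrow> f x \<noteq> []"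
  shows "polytime D ea e (\<lambda>x. hd (f x))"
  by (rule polytime_data_hd[OF assms(1)]) (use assms(2) in \<open>metis data_hd.simps(2) enc_list.simps(2) list.collapse\<close>)

lemma polytime_tl: "polytime D ea (enc_list e) f \<Longrightarrow> polytime D ea (enc_list e) (\<lambda>x. tl (f x))"
  by (rule polytime_data_tl, assumption) (metis data_tl.simps enc_list.simps list.exhaust list.sel(2,3))

lemma polytime_release: "polytime D ea enc_job f \<Longrightarrow> polytime D ea enc_nat (\<lambda>x. release (f x))"
  by (rule polytime_data_hd, assumption) (simp add: enc_job_def)

lemma polytime_deadline: "polytime D ea enc_job f \<Longrightarrow> polytime D ea enc_nat (\<lambda>x. deadline (f x))"
  by (rule polytime_data_hd[OF polytime_data_tl[where ec = "\<lambda>d. d"]], assumption) (auto simp: enc_job_def)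

lemma polytime_proc: "polytime D ea enc_job f \<Longrightarrow> polytime D ea enc_nat (\<lambda>x. proc (f x))"
  by (rule polytime_data_tl[OF polytime_data_tl[where ec = "\<lambda>d. d"]], assumption) (auto simp: enc_job_def)

lemma polytime_job:
  assumes "polytime D ea enc_nat f" "polytime D ea enc_nat g" "polytime D ea enc_nat h"
  shows "polytime D ea enc_job (\<lambda>x. \<lparr>release = f x, deadline = g x, proc = h x\<rparr>)"
  by (rule polytime_recode[OF polytime_Node[OF assms(1) polytime_Node[OF assms(2,3)]]]) (simp add: enc_job_def)

lemma polytime_num_slots: "polytime D ea enc_psba f \<Longrightarrow> polytime D ea enc_nat (\<lambda>x. num_slots (f x))"
  by (rule polytime_data_hd, assumption) (simp add: enc_psba_def)

lemma polytime_event_len: "polytime D ea enc_psba f \<Longrightarrow> polytime D ea (enc_list enc_nat) (\<lambda>x. event_len (f x))"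
  by (rule polytime_data_hd[OF polytime_data_tl[where ec = "\<lambda>d. d"]], assumption) (auto simp: enc_psba_def)

lemma polytime_job_sets:
  "polytime D ea enc_psba f \<Longrightarrow> polytime D ea (enc_list (enc_list enc_job)) (\<lambda>x. job_sets (f x))"
  by (rule polytime_data_tl[OF polytime_data_tl[where ec = "\<lambda>d. d"]], assumption) (auto simp: enc_psba_def)

lemma polytime_psba:
  assumes "polytime D ea enc_nat f" "polytime D ea (enc_list enc_nat) g"
    "polytime D ea (enc_list (enc_list enc_job)) h"
  shows "polytime D ea enc_psba (\<lambda>x. \<lparr>num_slots = f x, event_len = g x, job_sets = h x\<rparr>)"
  by (rule polytime_recode[OF polytime_Node[OF assms(1) polytime_Node[OF assms(2,3)]]]) (simp add: enc_psba_def)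

text \<open>Syntax-directed rules: applied repeatedly, they decompose a function term until nothing
  is left to show.\<close>

lemmas polytime_intros = polytime_id polytime_const polytime_if polytime_not polytime_conj polytime_disj
  polytime_noteq_bool polytime_Pair polytime_fst polytime_snd polytime_Cons polytime_tl
  polytime_release polytime_deadline polytime_proc polytime_job
  polytime_num_slots polytime_event_len polytime_job_sets polytime_psba

lemma size_enc_list_rev: "size (enc_list e (rev xs)) = size (enc_list e xs)"
  by (induction xs) (auto simp: size_enc_list_append)

lemma polytime_rev:
  assumes "polytime D ea (enc_list e) l"
  shows "polytime D ea (enc_list e) (\<lambda>x. rev (l x))"
proof -
  have rev: "foldl (\<lambda>acc a. a # acc) acc xs = rev xs @ acc" for acc xs :: "'b list"
    by (induction xs arbitrary: acc) auto
  obtain p where p: "\<And>x. x \<in> D \<Longrightarrow> size (enc_list e (l x)) \<le> poly p (size (ea x))"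
    using polytime_size[OF assms] by blast
  have "polytime D ea (enc_list e) (\<lambda>x. foldl (\<lambda>acc a. a # acc) [] (l x))"
  proof (rule polytime_foldl[where D' = UNIV and B = "poly p"])
    fix x pre post assume "x \<in> D" "l x = pre @ post"
    with p[of x] show "size (enc_list e (foldl (\<lambda>acc a. a # acc) [] pre)) \<le> poly p (size (ea x))"
      by (simp add: rev size_enc_list_rev size_enc_list_append)
  qed (rule polytime_intros assms poly_bounded_intros UNIV_I)+
  then show ?thesis by (simp add: rev)
qed

text \<open>Loops consume lists from the front, so a right fold runs as a left fold over the
  reversed list; its intermediate values belong to suffixes.\<close>

lemma polytime_foldr:
  assumes g: "polytime D' (enc_pair ea (enc_pair ee ec)) ec (\<lambda>z. g (fst z) (fst (snd z)) (snd (snd z)))"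
    and l: "polytime D ea (enc_list ee) l" and a: "polytime D ea ec a"
    and D': "\<And>x pre e post. x \<in> D \<Longrightarrow> l x = pre @ e # post \<Longrightarrow> (x, e, foldr (g x) post (a x)) \<in> D'"
    and B: "poly_bounded B"
    and sz: "\<And>x pre post. x \<in> D \<Longrightarrow> l x = pre @ post \<Longrightarrow> size (ec (foldr (g x) post (a x))) \<le> B (size (ea x))"
  shows "polytime D ea ec (\<lambda>x. foldr (g x) (l x) (a x))"
proof -
  have foldl: "foldl (\<lambda>acc e. g x e acc) acc xs = foldr (g x) (rev xs) acc" for x acc xs
    by (simp add: foldr_conv_foldl)
  have "polytime D ea ec (\<lambda>x. foldl (\<lambda>acc e. g x e acc) (a x) (rev (l x)))"
  proof (rule polytime_foldl[OF g polytime_rev[OF l] a _ B])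
    fix x pre e post assume x: "x \<in> D" "rev (l x) = pre @ e # post"
    then have "l x = rev post @ e # rev pre" by (metis append.assoc append_Cons append_Nil rev.simps(2) rev_append rev_swap)
    with x(1) D' show "(x, e, foldl (\<lambda>acc e. g x e acc) (a x) pre) \<in> D'" unfolding foldl by blast
  next
    fix x pre post assume x: "x \<in> D" "rev (l x) = pre @ post"
    then have "l x = rev post @ rev pre" by (metis rev_append rev_rev_ident)
    with x(1) sz show "size (ec (foldl (\<lambda>acc e. g x e acc) (a x) pre)) \<le> B (size (ea x))"
      unfolding foldl by blast
  qed
  then show ?thesis by (simp add: foldl)
qed

text \<open>The accumulators are bounded automatically: each result is polynomial in the size of its
  argument, and a list is no longer than its code is large.\<close>

lemma polytime_map:
  assumes g: "polytime UNIV (enc_pair ea ee) ef (\<lambda>z. g (fst z) (snd z))" and l: "polytime D ea (enc_list ee) l"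
  shows "polytime D ea (enc_list ef) (\<lambda>x. map (g x) (l x))"
proof -
  obtain p where p: "\<And>z. z \<in> UNIV \<Longrightarrow> size (ef (g (fst z) (snd z))) \<le> poly p (size (enc_pair ea ee z))"
    by (rule polytime_size[OF g]) (rule that)
  obtain q where q: "\<And>x. x \<in> D \<Longrightarrow> size (enc_list ee (l x)) \<le> poly q (size (ea x))"
    using polytime_size[OF l] by blast
  have map: "foldr (\<lambda>e acc. g x e # acc) xs [] = map (g x) xs" for x xs
    by (induction xs) auto
  have "polytime D ea (enc_list ef) (\<lambda>x. foldr (\<lambda>e acc. g x e # acc) (l x) [])"
  proof (rule polytime_foldr[where D' = UNIV and B = "\<lambda>n. poly q n * (poly p (n + poly q n + 1) + 1)"])
    have "polytime UNIV (enc_pair ea (enc_pair ee (enc_list ef))) (enc_pair ea ee) (\<lambda>z. (fst z, fst (snd z)))"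
      by (rule polytime_intros)+
    from polytime_comp[OF g this] show "polytime UNIV (enc_pair ea (enc_pair ee (enc_list ef))) (enc_list ef)
        (\<lambda>z. g (fst z) (fst (snd z)) # snd (snd z))"
      by (intro polytime_Cons) (simp, (rule polytime_intros)+)
    fix x pre post assume x: "x \<in> D" "l x = pre @ post"
    have "size (enc_list ef (map (g x) post)) \<le>
        length (map (g x) post) * (poly p (size (ea x) + poly q (size (ea x)) + 1) + 1)"
    proof (rule size_enc_list_le)
      fix y assume "y \<in> set (map (g x) post)"
      then obtain e where e: "e \<in> set post" "y = g x e" by auto
      then have "size (ee e) \<le> poly q (size (ea x))"
        using q[OF x(1)] size_enc_list_mem[of e "l x" ee] x(2) by simp
      then have "poly p (size (enc_pair ea ee (x, e))) \<le> poly p (size (ea x) + poly q (size (ea x)) + 1)"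
        by (intro poly_nat_mono) simp
      with p[of "(x, e)", OF UNIV_I] show "size (ef y) \<le> poly p (size (ea x) + poly q (size (ea x)) + 1)"
        by (simp add: e(2))
    qed
    also have "\<dots> \<le> poly q (size (ea x)) * (poly p (size (ea x) + poly q (size (ea x)) + 1) + 1)"
      using q[OF x(1)] length_le_size_enc_list[of "l x" ee] x(2) by (intro mult_right_mono) auto
    finally show "size (enc_list ef (foldr (\<lambda>e acc. g x e # acc) post [])) \<le>
      poly q (size (ea x)) * (poly p (size (ea x) + poly q (size (ea x)) + 1) + 1)"
      unfolding map .
  qed (rule polytime_intros l poly_bounded_intros UNIV_I)+
  then show ?thesis by (simp add: map)
qed

section \<open>Binary arithmetic on lists of bits\<close>

fun bits :: "nat \<Rightarrow> bool list" where
  "bits n = (if n = 0 then [] else odd n # bits (n div 2))"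

declare bits.simps [simp del]

text \<open>Recovers a number from its \<open>bits\<close>, but also accepts zeros at the most
  significant end, such as subtraction produces.\<close>

definition val :: "bool list \<Rightarrow> nat" where
  "val bs = foldr (\<lambda>b m. of_bool b + 2 * m) bs 0"

lemma val_simps [simp]: "val [] = 0" "val (b # bs) = of_bool b + 2 * val bs"
  by (simp_all add: val_def)

lemma enc_nat_eq: "enc_nat n = enc_list data_of_bool (bits n)"
  by (induction n rule: bits.induct) (simp add: enc_nat.simps bits.simps)

lemma val_bits [simp]: "val (bits n) = n"
proof (induction n rule: bits.induct)
  case (1 n)
  then show ?case by (cases "n = 0") (simp_all add: bits.simps[of n] bits.simps[of 0])
qed

lemma enc_nat_0 [simp]: "enc_nat 0 = Leaf"
  by (simp add: enc_nat.simps)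

text \<open>Prepending a zero bit to the number 0 must not create a node; the case distinction keeps
  codes canonical.\<close>

lemma enc_nat_val_Cons:
  "enc_nat (of_bool b + 2 * m) = (if \<not> b \<and> m = 0 then Leaf else Node (data_of_bool b) (enc_nat m))"
  by (subst enc_nat.simps) auto

lemma enc_nat_eq_Leaf_iff: "enc_nat n = Leaf \<longleftrightarrow> n = 0"
  by (simp add: enc_nat.simps[of n])

lemma polytime_bits: "polytime D ea enc_nat f \<Longrightarrow> polytime D ea (enc_list data_of_bool) (\<lambda>x. bits (f x))"
  by (erule polytime_recode) (simp add: enc_nat_eq)

lemma polytime_eq_0: "polytime D ea enc_nat f \<Longrightarrow> polytime D ea data_of_bool (\<lambda>x. f x = 0)"
  using polytime_eq_code[of D ea enc_nat f enc_nat "\<lambda>x. 0"] polytime_const[of D ea enc_nat 0]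
  by (simp add: enc_nat_eq_Leaf_iff)

lemma polytime_val:
  assumes "polytime D ea (enc_list data_of_bool) f"
  shows "polytime D ea enc_nat (\<lambda>x. val (f x))"
proof -
  have sz: "size (enc_nat (val bs)) \<le> size (enc_list data_of_bool bs)" for bs
    by (induction bs) (auto simp: enc_nat_val_Cons)
  obtain p where p: "\<And>x. x \<in> D \<Longrightarrow> size (enc_list data_of_bool (f x)) \<le> poly p (size (ea x))"
    using polytime_size[OF assms] by blast
  have step: "polytime UNIV (enc_pair ea (enc_pair data_of_bool enc_nat)) enc_nat
      (\<lambda>z. of_bool (fst (snd z)) + 2 * snd (snd z))" (is "polytime _ ?e _ _")
  proof (rule polytime_recode[OF polytime_if])
    show "polytime UNIV ?e data_of_bool (\<lambda>z. \<not> fst (snd z) \<and> snd (snd z) = 0)"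
      by (rule polytime_intros polytime_eq_0)+
    show "polytime UNIV ?e (\<lambda>d. d) (\<lambda>z. Leaf)" by (rule polytime_const)
    show "polytime UNIV ?e (\<lambda>d. d) (\<lambda>z. Node (data_of_bool (fst (snd z))) (enc_nat (snd (snd z))))"
      by (rule polytime_Node polytime_intros)+
  qed (simp only: enc_nat_val_Cons)
  show ?thesis unfolding val_def
  proof (rule polytime_foldr[OF step assms polytime_const UNIV_I poly_bounded_poly[OF poly_bounded_id]])
    fix x pre post assume "x \<in> D" "f x = pre @ post"
    with p[of x] sz[of post]
    show "size (enc_nat (foldr (\<lambda>b m. of_bool b + 2 * m) post 0)) \<le> poly p (size (ea x))"
      unfolding val_def[symmetric] by (simp add: size_enc_list_append)
  qed
qed

lemma val_less: "val bs < 2 ^ length bs"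
  by (induction bs) auto

text \<open>Full subtractor. The state holds the unread bits of the subtrahend, the borrow and the
  result bits in reverse; a missing bit counts as 0.\<close>

fun sub_step :: "bool list \<times> bool \<times> bool list \<Rightarrow> bool \<Rightarrow> bool list \<times> bool \<times> bool list" where
  "sub_step (bs, c, out) a = (let b = (bs \<noteq> [] \<and> hd bs) in
     (tl bs, (\<not> a \<and> (b \<or> c)) \<or> (b \<and> c), ((a \<noteq> b) \<noteq> c) # out))"

text \<open>Over the integers the difference may be negative: \<open>ds\<close> gives it modulo
  \<open>2 ^ length as\<close>, and the unread subtrahend plus the borrow counts the multiples still
  to be taken off. The size clause serves the accumulator bound.\<close>

lemma foldl_sub_step:
  "\<exists>bs' c' ds. foldl sub_step (bs, c, out) as = (bs', c', rev ds @ out) \<and> length ds = length as \<and>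
     size (enc_list data_of_bool bs') \<le> size (enc_list data_of_bool bs) \<and>
     int (val as) - int (val bs) - of_bool c = int (val ds) - 2 ^ length as * (int (val bs') + of_bool c')"
proof (induction as arbitrary: bs c out)
  case Nil
  then show ?case by simp
next
  case (Cons a as)
  define b where "b = (bs \<noteq> [] \<and> hd bs)"
  define c1 where "c1 = ((\<not> a \<and> (b \<or> c)) \<or> (b \<and> c))"
  define d where "d = ((a \<noteq> b) \<noteq> c)"
  obtain bs' c' ds where IH: "foldl sub_step (tl bs, c1, d # out) as = (bs', c', rev ds @ d # out)"
    "length ds = length as" "size (enc_list data_of_bool bs') \<le> size (enc_list data_of_bool (tl bs))"
    "int (val as) - int (val (tl bs)) - of_bool c1 = int (val ds) - 2 ^ length as * (int (val bs') + of_bool c')"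
    using Cons.IH by blast
  have "val bs = of_bool b + 2 * val (tl bs)" by (cases bs) (auto simp: b_def)
  moreover have "of_bool a - of_bool b - of_bool c = (of_bool d - 2 * of_bool c1 :: int)"
    by (auto simp: d_def c1_def)
  ultimately have "int (val (a # as)) - int (val bs) - of_bool c =
      of_bool d + 2 * (int (val as) - int (val (tl bs)) - of_bool c1)" by simp
  also have "\<dots> = int (val (d # ds)) - 2 ^ length (a # as) * (int (val bs') + of_bool c')"
    unfolding IH(4) by (simp add: algebra_simps)
  finally have "int (val (a # as)) - int (val bs) - of_bool c =
      int (val (d # ds)) - 2 ^ length (a # as) * (int (val bs') + of_bool c')" .
  moreover have "foldl sub_step (bs, c, out) (a # as) = (bs', c', rev (d # ds) @ out)"
    using IH(1) by (simp add: Let_def b_def c1_def d_def)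
  moreover have "size (enc_list data_of_bool (tl bs)) \<le> size (enc_list data_of_bool bs)"
    by (cases bs) auto
  ultimately show ?case using IH(2,3) by (metis le_trans length_Cons)
qed

text \<open>Since the result bits stay below \<open>2 ^ length (bits m)\<close>, the difference is
  negative exactly when a borrow or a nonzero rest of the subtrahend is left; truncation then yields
  0.\<close>

lemma diff_eq_foldl_sub_step:
  fixes m n :: nat
  defines "r \<equiv> foldl sub_step (bits n, False, []) (bits m)"
  shows "m - n = (if fst (snd r) \<or> val (fst r) \<noteq> 0 then 0 else val (rev (snd (snd r))))"
proof -
  obtain bs' c' ds where r: "r = (bs', c', rev ds)" "length ds = length (bits m)"
    "int m - int n = int (val ds) - 2 ^ length (bits m) * (int (val bs') + of_bool c')"
    using foldl_sub_step[of "bits n" False "[]" "bits m"] unfolding r_def by auto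
  show ?thesis
  proof (cases "c' \<or> val bs' \<noteq> 0")
    case True
    then have "1 \<le> int (val bs') + of_bool c'" by auto
    then have "(2::int) ^ length (bits m) * 1 \<le> 2 ^ length (bits m) * (int (val bs') + of_bool c')"
      by (intro mult_left_mono) auto
    moreover have "int (val ds) < 2 ^ length (bits m)"
      using val_less[of ds] r(2) by (metis of_nat_less_numeral_power_cancel_iff)
    ultimately have "int m < int n" using r(3) by linarith
    with True show ?thesis by (simp add: r(1))
  next
    case False
    then show ?thesis using r(3) by (simp add: r(1))
  qed
qed

lemma polytime_diff:
  assumes f: "polytime D ea enc_nat f" and g: "polytime D ea enc_nat g"
  shows "polytime D ea enc_nat (\<lambda>x. f x - g x)"
proof -
  let ?e = "enc_pair enc_nat enc_nat" and ?b = "enc_list data_of_bool"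
  let ?ec = "enc_pair ?b (enc_pair data_of_bool ?b)"
  \<comment> \<open>The head of the empty list's code is \<open>Leaf\<close>, the code of false:
    padding with zeros costs no test.\<close>
  have hd: "polytime UNIV ea data_of_bool (\<lambda>x. h x \<noteq> [] \<and> hd (h x))"
    if "polytime UNIV ea ?b h" for ea :: "'x \<Rightarrow> data" and h
  proof (rule polytime_data_hd[OF that])
    show "data_hd (?b (h x)) = data_of_bool (h x \<noteq> [] \<and> hd (h x))" for x
      by (cases "h x") (auto simp: data_of_bool_def)
  qed
  have step: "sub_step s a = (let b = (fst s \<noteq> [] \<and> hd (fst s)); c = fst (snd s) in
     (tl (fst s), (\<not> a \<and> (b \<or> c)) \<or> (b \<and> c), ((a \<noteq> b) \<noteq> c) # snd (snd s)))" for s a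
    by (cases s) (simp add: Let_def)
  have sub: "polytime UNIV ?e ?ec (\<lambda>z. foldl sub_step (bits (snd z), False, []) (bits (fst z)))"
  \<comment> \<open>Two pair nodes and one for the borrow, \<open>n\<close> for the unread bits, and
    at most two nodes for each result bit.\<close>
  proof (rule polytime_foldl[where D' = UNIV and B = "\<lambda>n. 3 + n + 2 * n"])
    show "polytime UNIV (enc_pair ?e (enc_pair data_of_bool ?ec)) ?ec (\<lambda>z. sub_step (snd (snd z)) (fst (snd z)))"
      unfolding step Let_def by (rule polytime_intros hd)+
    fix z :: "nat \<times> nat" and pre post
    assume "bits (fst z) = pre @ post"
    then have pre: "length pre \<le> size (enc_nat (fst z))"
      using length_le_size_enc_list[of "bits (fst z)" data_of_bool] by (simp add: enc_nat_eq)
    obtain bs' c' ds where fold: "foldl sub_step (bits (snd z), False, []) pre = (bs', c', rev ds)"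
      "length ds = length pre" "size (?b bs') \<le> size (enc_nat (snd z))"
      using foldl_sub_step[of "bits (snd z)" False "[]" pre] by (auto simp: enc_nat_eq)
    have "size (?b (rev ds)) \<le> length (rev ds) * (1 + 1)"
      by (rule size_enc_list_le) (simp add: data_of_bool_def)
    moreover have "size (data_of_bool c') \<le> 1" by (simp add: data_of_bool_def)
    moreover have "size (enc_nat (fst z)) + size (enc_nat (snd z)) \<le> size (?e z)" by (cases z) simp
    ultimately show "size (?ec (foldl sub_step (bits (snd z), False, []) pre)) \<le> 3 + size (?e z) + 2 * size (?e z)"
      using fold pre by simp
  qed (rule polytime_intros polytime_bits poly_bounded_intros UNIV_I)+
  have "polytime UNIV ?e enc_nat (\<lambda>z. fst z - snd z)"
    unfolding diff_eq_foldl_sub_step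
    by (rule polytime_if polytime_disj polytime_not polytime_eq_0 polytime_val polytime_rev
        polytime_const polytime_fst polytime_snd sub)+
  from polytime_comp[OF this polytime_Pair[OF f g]] show ?thesis by simp
qed

lemma polytime_le:
  assumes "polytime D ea enc_nat f" "polytime D ea enc_nat g"
  shows "polytime D ea data_of_bool (\<lambda>x. f x \<le> g x)"
  using polytime_eq_0[OF polytime_diff[OF assms]] by simp

lemma polytime_min:
  assumes "polytime D ea enc_nat f" "polytime D ea enc_nat g"
  shows "polytime D ea enc_nat (\<lambda>x. min (f x) (g x))"
proof -
  have "min m n = m - (m - n)" for m n :: nat by simp
  with polytime_diff[OF assms(1) polytime_diff[OF assms]] show ?thesis by simp
qed

text \<open>The successor is computed by subtraction from a larger number that has only one-bits.\<close>

lemma polytime_Suc: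
  assumes "polytime D ea enc_nat f"
  shows "polytime D ea enc_nat (\<lambda>x. Suc (f x))"
proof -
  let ?M = "\<lambda>n. val (True # map (\<lambda>_. True) (bits n))"
  have "val bs \<le> val (map (\<lambda>_. True) bs)" for bs by (induction bs) auto
  from this[of "bits n" for n] have "Suc n \<le> ?M n" for n by (simp add: trans_le_add1 mult_2)
  then have eq: "Suc n = ?M n - (?M n - n - 1)" for n
    by (metis Suc_diff_diff Suc_leD diff_diff_cancel diff_Suc_1 diff_diff_left plus_1_eq_Suc add.commute)
  show ?thesis
    by (subst eq) (rule polytime_diff polytime_val polytime_Cons polytime_map polytime_bits polytime_const assms)+
qed

section \<open>The greedy algorithm in polynomial time\<close>

text \<open>Sizes are not monotone, as a one bit costs two nodes and a zero bit only one; the factor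
  2 absorbs this.\<close>

lemma size_enc_nat_mono: "m \<le> n \<Longrightarrow> size (enc_nat m) \<le> 2 * size (enc_nat n)"
proof (induction n arbitrary: m rule: less_induct)
  case (less n)
  show ?case
  proof (cases "m = 0")
    case False
    with less.prems have n: "n \<noteq> 0" by simp
    then have "size (enc_nat (m div 2)) \<le> 2 * size (enc_nat (n div 2))"
      using less.prems by (intro less.IH) (auto intro: div_le_mono)
    with n False show ?thesis by (simp add: enc_nat.simps[of m] enc_nat.simps[of n] data_of_bool_def)
  qed simp
qed

text \<open>Exponential if applied to slots, but adequate for event indices, which are at most the
  input size.\<close>

lemma size_enc_nat_le: "size (enc_nat n) \<le> 2 * n"
proof (induction n rule: less_induct)
  case (less n)
  show ?case
  proof (cases "n = 0")
    case False
    with less.IH[of "n div 2"] have "size (enc_nat (n div 2)) \<le> 2 * (n div 2)" by simp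
    moreover have "2 * (n div 2) + of_bool (odd n) = n" by (cases "even n") auto
    ultimately show ?thesis using False
      by (cases "odd n") (auto simp: enc_nat.simps[of n] data_of_bool_def)
  qed simp
qed

lemma polytime_slack:
  assumes "polytime D ea (enc_list enc_job) K" "polytime D ea enc_nat a" "polytime D ea enc_nat b"
  shows "polytime D ea enc_nat (\<lambda>x. slack (K x) (a x) (b x))"
proof -
  let ?e = "enc_pair (enc_list enc_job) (enc_pair enc_nat enc_nat)"
  have "polytime UNIV ?e enc_nat (\<lambda>z. slack (fst z) (fst (snd z)) (snd (snd z)))"
    unfolding slack_def
  proof (rule polytime_foldl[where D' = UNIV and B = "\<lambda>n. 2 * n"])
    fix z :: "job list \<times> nat \<times> nat" and pre
    have "foldl (\<lambda>s k. if fst (snd z) \<le> release k \<and> deadline k \<le> snd (snd z) then s - proc k else s)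
        (snd (snd z) - (fst (snd z) - 1)) pre \<le> snd (snd z)" (is "?s \<le> _")
      unfolding foldl_diff_eq by simp
    then have "size (enc_nat ?s) \<le> 2 * size (enc_nat (snd (snd z)))" by (rule size_enc_nat_mono)
    also have "size (enc_nat (snd (snd z))) \<le> size (?e z)" by (cases z) simp
    finally show "size (enc_nat ?s) \<le> 2 * size (?e z)" by simp
  qed (rule polytime_intros polytime_diff polytime_le poly_bounded_intros UNIV_I)+
  from polytime_comp[OF this polytime_Pair[OF assms(1) polytime_Pair[OF assms(2,3)]]] show ?thesis by simp
qed

lemma foldl_le:
  fixes m :: nat
  assumes "\<And>m x. f m x \<le> m"
  shows "foldl f m xs \<le> m"
  using assms by (induction xs arbitrary: m) (auto intro: order_trans)

text \<open>Both folds only lower their start value, so every intermediate code is at most twice as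
  large as that of the start value.\<close>

lemma polytime_max_proc:
  assumes "polytime D ea enc_job j" "polytime D ea (enc_list enc_job) K"
  shows "polytime D ea enc_nat (\<lambda>x. max_proc (j x) (K x))"
proof -
  let ?e = "enc_pair enc_job (enc_list enc_job)"
  let ?step = "\<lambda>j K x m y. if release x \<le> release j \<and> deadline j \<le> deadline y
       then min m (slack K (release x) (deadline y)) else m"
  have inner_le: "foldl (?step j K x) m xs \<le> m" for j K x m xs
    by (rule foldl_le) auto
  have inner: "polytime UNIV (enc_pair ?e (enc_pair enc_job enc_nat)) enc_nat
      (\<lambda>w. foldl (?step (fst (fst w)) (snd (fst w)) (fst (snd w))) (snd (snd w)) (fst (fst w) # snd (fst w)))"
    (is "polytime _ ?ew _ _")
  proof (rule polytime_foldl[where D' = UNIV and B = "\<lambda>n. 2 * n"])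
    fix w :: "(job \<times> job list) \<times> job \<times> nat" and pre
    have "size (enc_nat (foldl (?step (fst (fst w)) (snd (fst w)) (fst (snd w))) (snd (snd w)) pre))
        \<le> 2 * size (enc_nat (snd (snd w)))"
      by (intro size_enc_nat_mono inner_le)
    also have "size (enc_nat (snd (snd w))) \<le> size (?ew w)" by (cases w) simp
    finally show "size (enc_nat (foldl (?step (fst (fst w)) (snd (fst w)) (fst (snd w))) (snd (snd w)) pre))
        \<le> 2 * size (?ew w)" by simp
  qed (rule polytime_intros polytime_min polytime_slack polytime_le poly_bounded_intros UNIV_I)+
  have "polytime UNIV ?e enc_nat (\<lambda>z. max_proc (fst z) (snd z))"
    unfolding max_proc_def
  proof (rule polytime_foldl[where D' = UNIV and B = "\<lambda>n. 2 * n", OF inner])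
    fix z :: "job \<times> job list" and pre
    have "size (enc_nat (foldl (\<lambda>m x. foldl (?step (fst z) (snd z) x) m (fst z # snd z)) (proc (fst z)) pre))
        \<le> 2 * size (enc_nat (proc (fst z)))"
      by (intro size_enc_nat_mono foldl_le inner_le)
    also have "size (enc_nat (proc (fst z))) \<le> size (?e z)" by (cases z) (simp add: enc_job_def)
    finally show "size (enc_nat (foldl (\<lambda>m x. foldl (?step (fst z) (snd z) x) m (fst z # snd z)) (proc (fst z)) pre))
        \<le> 2 * size (?e z)" by simp
  qed (rule polytime_intros poly_bounded_intros UNIV_I)+
  from polytime_comp[OF this polytime_Pair[OF assms]] show ?thesis by simp
qed

text \<open>Each job of the result has the interval of an input job and at most its processing time,
  so its code at most doubles, and only one job is added.\<close>

lemma polytime_reserve: "polytime UNIV (enc_pair enc_job (enc_list enc_job)) (enc_list enc_job)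
  (\<lambda>z. reserve (fst z) (snd z))" (is "polytime _ ?e _ _")
  unfolding reserve_def shrink_def
proof (rule polytime_foldr[where D' = UNIV and B = "\<lambda>n. (n + 1) * (2 * n + 1)"])
  fix z :: "job \<times> job list" and pre post
  assume z: "snd z = pre @ post"
  have size_job: "size (enc_job k) \<le> 2 * size (enc_job j)"
    if "release k = release j" "deadline k = deadline j" "proc k \<le> proc j" for j k
    using that size_enc_nat_mono[of "proc k" "proc j"] by (simp add: enc_job_def)
  have "size (enc_list enc_job (reserve (fst z) post)) \<le> length (reserve (fst z) post) * (2 * size (?e z) + 1)"
  proof (rule size_enc_list_le)
    fix k assume "k \<in> set (reserve (fst z) post)"
    then obtain j where j: "j = fst z \<or> j \<in> set post" and "size (enc_job k) \<le> 2 * size (enc_job j)"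
      using reserve_mem size_job by (metis order_refl)
    moreover have "size (enc_job j) \<le> size (?e z)"
      using j size_enc_list_mem[of j "snd z" enc_job] z by (cases z) fastforce
    ultimately show "size (enc_job k) \<le> 2 * size (?e z)" by linarith
  qed
  also have "\<dots> \<le> (size (?e z) + 1) * (2 * size (?e z) + 1)"
    using length_le_size_enc_list[of "snd z" enc_job] z
    by (intro mult_right_mono) (cases z, auto)
  finally show "size (enc_list enc_job (foldr (\<lambda>j K. \<lparr>release = release j, deadline = deadline j,
      proc = max_proc j K\<rparr> # K) post [fst z])) \<le> (size (?e z) + 1) * (2 * size (?e z) + 1)"
    by (simp add: reserve_def shrink_def)
qed (rule polytime_intros polytime_max_proc poly_bounded_intros UNIV_I)+

text \<open>\<open>greedy_starts\<close> as a loop body. The state holds the contracted job sets,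
  the index of the next event and the output, which grows in reverse.\<close>

definition greedy_step :: "(psba \<Rightarrow> nat) \<Rightarrow> nat \<Rightarrow> job list list \<times> nat \<times> (nat \<times> nat) list \<Rightarrow> nat \<Rightarrow>
    job list list \<times> nat \<times> (nat \<times> nat) list" where
  "greedy_step h T st l =
     (map (reserve (event_job T l (h \<lparr>num_slots = T, event_len = [l], job_sets = fst st\<rparr>))) (fst st),
      Suc (fst (snd st)),
      (fst (snd st), h \<lparr>num_slots = T, event_len = [l], job_sets = fst st\<rparr>) # snd (snd st))"

text \<open>A bound that doubles with each reservation would be exponential over many events. The
  invariant says instead that the instance stays valid, so all numbers in it are at most
  \<open>T\<close>, and that each job list grows by at most one job per event.\<close>

lemma foldl_greedy_step:
  assumes h: "single_event_approx \<alpha> h"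
    and "valid_psba \<lparr>num_slots = T, event_len = pre @ post, job_sets = Js\<rparr>" "\<And>J. J \<in> set Js \<Longrightarrow> length J \<le> n"
  shows "\<exists>Js'. foldl (greedy_step h T) (Js, k, out) pre =
      (Js', k + length pre, rev (zip [k..<k + length pre] (greedy_starts h T Js pre)) @ out) \<and>
    valid_psba \<lparr>num_slots = T, event_len = post, job_sets = Js'\<rparr> \<and>
    length Js' = length Js \<and> (\<forall>J\<in>set Js'. length J \<le> n + length pre)"
  using assms(2-)
proof (induction pre arbitrary: Js k n out)
  case Nil
  then show ?case by simp
next
  case (Cons l pre)
  let ?t = "h \<lparr>num_slots = T, event_len = [l], job_sets = Js\<rparr>"
  let ?Js = "map (reserve (event_job T l ?t)) Js"
  have t: "?t \<in> {1..T}"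
    using h valid_psba_single Cons.prems(1) unfolding single_event_approx_def Let_def by (metis append_Cons)
  have "\<exists>Js'. foldl (greedy_step h T) (?Js, Suc k, (k, ?t) # out) pre =
      (Js', Suc k + length pre, rev (zip [Suc k..<Suc k + length pre] (greedy_starts h T ?Js pre)) @ (k, ?t) # out) \<and>
    valid_psba \<lparr>num_slots = T, event_len = post, job_sets = Js'\<rparr> \<and>
    length Js' = length ?Js \<and> (\<forall>J\<in>set Js'. length J \<le> Suc n + length pre)"
  proof (rule Cons.IH)
    show "valid_psba \<lparr>num_slots = T, event_len = pre @ post, job_sets = ?Js\<rparr>"
      by (rule valid_psba_reserve[OF _ t]) (use Cons.prems(1) in simp)
  qed (use Cons.prems(2) in auto)
  moreover have "[k..<Suc (k + length pre)] = k # [Suc k..<Suc (k + length pre)]"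
    by (simp add: upt_conv_Cons del: upt_Suc)
  moreover have "greedy_step h T (Js, k, out) l = (?Js, Suc k, (k, ?t) # out)"
    by (simp add: greedy_step_def)
  ultimately show ?case by (simp add: Let_def del: upt_Suc)
qed

lemma size_enc_psba:
  "size (enc_nat (num_slots I)) \<le> size (enc_psba I)"
  "length (event_len I) \<le> size (enc_psba I)"
  "length (job_sets I) \<le> size (enc_psba I)"
  "J \<in> set (job_sets I) \<Longrightarrow> length J \<le> size (enc_psba I)"
  using length_le_size_enc_list[of "event_len I" enc_nat]
    length_le_size_enc_list[of "job_sets I" "enc_list enc_job"]
    length_le_size_enc_list[of J enc_job] size_enc_list_mem[of J "job_sets I" "enc_list enc_job"]
  by (auto simp: enc_psba_def)

lemma polytime_greedy:
  assumes h: "single_event_approx \<alpha> h"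
    and poly: "polytime {I. valid_psba I \<and> length (event_len I) = 1} enc_psba enc_nat h"
  shows "polytime {I. valid_psba I} enc_psba (enc_list (enc_pair enc_nat enc_nat))
    (\<lambda>I. snd (snd (foldl (greedy_step h (num_slots I)) (job_sets I, 0, []) (event_len I))))"
proof -
  let ?Js = "enc_list (enc_list enc_job)" and ?out = "enc_list (enc_pair enc_nat enc_nat)"
  let ?st = "enc_pair ?Js (enc_pair enc_nat ?out)"
  let ?e = "enc_pair enc_psba (enc_pair enc_nat ?st)"
  \<comment> \<open>The time bound for \<open>h\<close> is available only on valid instances with
    one event, so the loop body is treated only on states that produce such instances.\<close>
  define D' :: "(psba \<times> nat \<times> job list list \<times> nat \<times> (nat \<times> nat) list) set" where
    "D' = {z. valid_psba \<lparr>num_slots = num_slots (fst z), event_len = [fst (snd z)], job_sets = fst (snd (snd z))\<rparr>}"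
  have t: "polytime D' ?e enc_nat
     (\<lambda>z. h \<lparr>num_slots = num_slots (fst z), event_len = [fst (snd z)], job_sets = fst (snd (snd z))\<rparr>)"
    by (rule polytime_comp[OF poly]) ((rule polytime_intros)+, simp add: D'_def)
  have job: "polytime D' ?e enc_job (\<lambda>z. event_job (num_slots (fst z)) (fst (snd z))
     (h \<lparr>num_slots = num_slots (fst z), event_len = [fst (snd z)], job_sets = fst (snd (snd z))\<rparr>))"
    unfolding event_job_def by (rule t polytime_intros polytime_diff)+
  have map: "polytime UNIV (enc_pair enc_job ?Js) ?Js (\<lambda>z. map (reserve (fst z)) (snd z))"
  proof (rule polytime_map)
    have "polytime UNIV (enc_pair (enc_pair enc_job ?Js) (enc_list enc_job)) (enc_pair enc_job (enc_list enc_job))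
        (\<lambda>z. (fst (fst z), snd z))"
      by (rule polytime_intros)+
    from polytime_comp[OF polytime_reserve this]
    show "polytime UNIV (enc_pair (enc_pair enc_job ?Js) (enc_list enc_job)) (enc_list enc_job)
        (\<lambda>z. reserve (fst (fst z)) (snd z))" by simp
  qed (rule polytime_intros)+
  have fst_st: "polytime D' ?e ?Js (\<lambda>z. fst (snd (snd z)))"
    by (rule polytime_intros)+
  have step: "polytime D' ?e ?st (\<lambda>z. greedy_step h (num_slots (fst z)) (snd (snd z)) (fst (snd z)))"
    unfolding greedy_step_def
    by (rule t polytime_comp[OF map polytime_Pair[OF job fst_st], simplified] polytime_Suc polytime_intros)+
  \<comment> \<open>Two pair nodes; \<open>n\<close> agents with up to \<open>n + n\<close> jobs,
    each coded by two nodes and three numbers of size \<open>2 * n\<close>; the counter; and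
    \<open>n\<close> output pairs.\<close>
  define B where "B = (\<lambda>n::nat. 2 + n * ((n + n) * (2 + 6 * n + 1) + 1) + 2 * n + n * (1 + 2 * n + 2 * n + 1))"
  have "polytime {I. valid_psba I} enc_psba ?st
      (\<lambda>I. foldl (greedy_step h (num_slots I)) (job_sets I, 0, []) (event_len I))"
  proof (rule polytime_foldl[OF step, where B = B])
    fix I pre l post assume I: "I \<in> {I. valid_psba I}" "event_len I = pre @ l # post"
    then have I': "valid_psba \<lparr>num_slots = num_slots I, event_len = pre @ l # post, job_sets = job_sets I\<rparr>"
      by (cases I) simp
    obtain Js' where "fst (foldl (greedy_step h (num_slots I)) (job_sets I, 0, []) pre) = Js'"
      "valid_psba \<lparr>num_slots = num_slots I, event_len = l # post, job_sets = Js'\<rparr>"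
      using foldl_greedy_step[OF h I', of "size (enc_psba I)" 0 "[]"] size_enc_psba(4) by fastforce
    then show "(I, l, foldl (greedy_step h (num_slots I)) (job_sets I, 0, []) pre) \<in> D'"
      using valid_psba_single by (simp add: D'_def)
  next
    fix I pre post assume I: "I \<in> {I. valid_psba I}" "event_len I = pre @ post"
    let ?n = "size (enc_psba I)" and ?ts = "greedy_starts h (num_slots I) (job_sets I) pre"
    have I': "valid_psba \<lparr>num_slots = num_slots I, event_len = pre @ post, job_sets = job_sets I\<rparr>"
      using I by (cases I) simp
    obtain Js' where fold: "foldl (greedy_step h (num_slots I)) (job_sets I, 0, []) pre =
        (Js', length pre, rev (zip [0..<length pre] ?ts))"
      and valid: "valid_psba \<lparr>num_slots = num_slots I, event_len = post, job_sets = Js'\<rparr>"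
      and len: "length Js' = length (job_sets I)" "\<And>J. J \<in> set Js' \<Longrightarrow> length J \<le> ?n + length pre"
      using foldl_greedy_step[OF h I', of ?n 0 "[]"] size_enc_psba(4) by auto
    have pre: "length pre \<le> ?n" using size_enc_psba(2)[of I] I(2) by simp
    have slot: "size (enc_nat s) \<le> 2 * ?n" if "s \<le> num_slots I" for s
      using size_enc_nat_mono[OF that] size_enc_psba(1)[of I] by linarith
    have "size (enc_job j) \<le> 2 + 6 * ?n" if "J \<in> set Js'" "j \<in> set J" for J j
    proof -
      have "valid_job \<lparr>num_slots = num_slots I, event_len = post, job_sets = Js'\<rparr> j"
        using valid that by (simp add: valid_psba_def)
      then have "release j \<le> num_slots I" "deadline j \<le> num_slots I" "proc j \<le> num_slots I"
        by (auto simp: valid_job_def time_slots_def)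
      from this[THEN slot] show ?thesis by (simp add: enc_job_def)
    qed
    then have "size (enc_list enc_job J) \<le> length J * (2 + 6 * ?n + 1)" if "J \<in> set Js'" for J
      using that by (intro size_enc_list_le) blast
    then have "size (enc_list enc_job J) \<le> (?n + ?n) * (2 + 6 * ?n + 1)" if "J \<in> set Js'" for J
      using that len(2)[OF that] pre
      by (meson add_left_mono mult_le_mono1 order_trans)
    then have "size (?Js Js') \<le> length Js' * ((?n + ?n) * (2 + 6 * ?n + 1) + 1)"
      by (rule size_enc_list_le)
    also have "\<dots> \<le> ?n * ((?n + ?n) * (2 + 6 * ?n + 1) + 1)"
      unfolding len(1) by (intro mult_right_mono size_enc_psba(3)) simp
    finally have "size (?Js Js') \<le> ?n * ((?n + ?n) * (2 + 6 * ?n + 1) + 1)" .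
    moreover have "size (enc_nat (length pre)) \<le> 2 * ?n"
      using size_enc_nat_le[of "length pre"] pre by linarith
    moreover have "size (?out (rev (zip [0..<length pre] ?ts))) \<le> ?n * (1 + 2 * ?n + 2 * ?n + 1)"
    proof -
      have "size (enc_pair enc_nat enc_nat p) \<le> 1 + 2 * ?n + 2 * ?n" if "p \<in> set (rev (zip [0..<length pre] ?ts))" for p
      proof -
        have "(fst p, snd p) \<in> set (zip [0..<length pre] ?ts)" using that by simp
        then have p: "fst p < length pre" "snd p \<in> set ?ts"
          using set_zip_leftD set_zip_rightD by fastforce+
        have "valid_psba \<lparr>num_slots = num_slots I, event_len = pre, job_sets = job_sets I\<rparr>"
          using I' by (auto simp: valid_psba_def valid_job_def time_slots_def)
        with p(2) have "snd p \<le> num_slots I" using greedy_starts_range[OF h] by fastforce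
        moreover have "size (enc_nat (fst p)) \<le> 2 * ?n"
          using size_enc_nat_le[of "fst p"] p(1) pre by linarith
        ultimately show ?thesis using slot[of "snd p"] by (cases p) simp
      qed
      then have "size (?out (rev (zip [0..<length pre] ?ts))) \<le>
          length (rev (zip [0..<length pre] ?ts)) * (1 + 2 * ?n + 2 * ?n + 1)"
        by (rule size_enc_list_le)
      also have "\<dots> \<le> ?n * (1 + 2 * ?n + 2 * ?n + 1)" using pre by (intro mult_right_mono) auto
      finally show ?thesis .
    qed
    ultimately show "size (?st (foldl (greedy_step h (num_slots I)) (job_sets I, 0, []) pre)) \<le> B ?n"
      unfolding fold B_def by simp
  next
    show "poly_bounded B" unfolding B_def by (intro poly_bounded_intros)
  qed (rule polytime_intros)+
  then show ?thesis by (intro polytime_snd)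
qed

theorem theorem3:
  fixes \<alpha> :: real
  assumes "\<alpha> \<ge> 1"
    and "\<exists>c. polytime_approx (\<lambda>I. length (event_len I) = 1) (1 / \<alpha>) c"
  shows "\<exists>c. polytime_approx (\<lambda>I. True) (1 / (\<alpha> + 1)) c"
proof -
  have enc_schedule: "enc_schedule = enc_list (enc_pair enc_nat enc_nat)"
    unfolding enc_schedule_def by (rule arg_cong[where f = enc_list]) auto
  let ?D1 = "{I. valid_psba I \<and> length (event_len I) = 1}"
  obtain c p where "\<forall>I\<in>?D1. \<exists>xs. \<exists>n. computes_in c (enc_psba I) (enc_schedule xs) n \<and>
      n \<le> poly p (size (enc_psba I)) \<and> complete_schedule I (set xs) \<and>
      real (schedule_value I (set xs)) \<ge> 1 / \<alpha> * real (opt_value I)"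
    using assms(2) unfolding polytime_approx_def by blast
  then obtain f where f: "\<And>I. I \<in> ?D1 \<Longrightarrow> \<exists>n. computes_in c (enc_psba I) (enc_schedule (f I)) n \<and>
      n \<le> poly p (size (enc_psba I)) \<and> complete_schedule I (set (f I)) \<and>
      real (schedule_value I (set (f I))) \<ge> 1 / \<alpha> * real (opt_value I)"
    by (metis (no_types, lifting) bchoice)
  define h where "h = (\<lambda>I. snd (hd (f I)))"
  have "polytime ?D1 enc_psba enc_schedule f"
    unfolding polytime_def using f by blast
  moreover have approx: "single_event_approx \<alpha> h" and ne: "\<And>I. I \<in> ?D1 \<Longrightarrow> f I \<noteq> []"
    using single_event_approxI[OF assms(1), of f] f unfolding h_def by blast+
  ultimately have "polytime ?D1 enc_psba enc_nat h"
    unfolding h_def enc_schedule by (intro polytime_snd polytime_hd) auto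
  from polytime_greedy[OF approx this] obtain c' q where c': "\<And>I. valid_psba I \<Longrightarrow> \<exists>n. computes_in c' (enc_psba I)
      (enc_schedule (snd (snd (foldl (greedy_step h (num_slots I)) (job_sets I, 0, []) (event_len I))))) n \<and>
      n \<le> poly q (size (enc_psba I))"
    unfolding polytime_def enc_schedule by blast
  have "polytime_approx (\<lambda>I. True) (1 / (\<alpha> + 1)) c'"
    unfolding polytime_approx_def
  proof (intro exI[of _ q] allI impI)
    fix I assume "valid_psba I \<and> True"
    then have I: "valid_psba I" by simp
    let ?xs = "snd (snd (foldl (greedy_step h (num_slots I)) (job_sets I, 0, []) (event_len I)))"
    have "valid_psba \<lparr>num_slots = num_slots I, event_len = event_len I @ [], job_sets = job_sets I\<rparr>"
      using I by (cases I) simp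
    from foldl_greedy_step[OF approx this, of "size (enc_psba I)" 0 "[]"] size_enc_psba(4)
    have "?xs = rev (zip [0..<length (event_len I)] (greedy_starts h (num_slots I) (job_sets I) (event_len I)))"
      by auto
    \<comment> \<open>The loop collects its output in reverse order, but the schedule is only the
      set of its pairs.\<close>
    then have "set ?xs = set (zip [0..<length (event_len I)] (greedy_starts h (num_slots I) (job_sets I) (event_len I)))"
      by simp
    from greedy_schedule[OF approx assms(1) I this] c'[OF I]
    show "\<exists>xs n. computes_in c' (enc_psba I) (enc_schedule xs) n \<and> n \<le> poly q (size (enc_psba I)) \<and>
        complete_schedule I (set xs) \<and> real (schedule_value I (set xs)) \<ge> 1 / (\<alpha> + 1) * real (opt_value I)"
      by blast
  qed
  then show ?thesis by blast
qed

end
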